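(* Let $n$ and $k$ be integers with $0\le k\le n-3$. Among all connected graphs with $n$ vertices and exactly $k$ cut edges, the first graph in the $S$-order is uniquely $P_n^k$; that is, $P_n^k\in\mathscr{G}_n^k$ and $P_n^k\prec_s G$ for every $G\in\mathscr{G}_n^k$ not isomorphic to $P_n^k$.
   Context: All graphs are finite, simple, undirected and connected. A cut edge of a connected graph is an edge whose deletion breaks the graph into two components. $\mathscr{G}_n^k$ is the set of all connected $n$-vertex graphs with exactly $k$ cut edges (graphs are considered up to isomorphism). For an $n$-vertex graph $G$ with adjacency eigenvalues $\lambda_1(G)\ge\dots\ge\lambda_n(G)$, the $i$th spectral moment is $S_i(G)=\sum_{j=1}^n\lambda_j(G)^i$ for $i=0,1,\dots,n-1$. For two $n$-vertex graphs $G_1,G_2$, write $G_1\prec_s G_2$ ($G_1$ comes before $G_2$ in the $S$-order) if for some $j\in\{1,\dots,n-1\}$ we have $S_i(G_1)=S_i(G_2)$ for $i=0,1,\dots,j-1$ and $S_j(G_1)<S_j(G_2)$. $P_m$ and $C_m$ are the path and the cycle on $m$ vertices. $P_n^k$ is the $n$-vertex graph obtained by identifying one end-vertex of the path $P_{k+1}$ with one vertex of the cycle $C_{n-k}$ (so $P_n^0=C_n$). *)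

theory Defs
  imports "Graph_Theory.Graph_Theory" "Jordan_Normal_Form.Char_Poly"
begin

text \<open>
  Finite simple undirected graphs are modelled by the locale \<open>pair_graph\<close> (finite, loopless,
  symmetric); an undirected edge is the pair of opposite arcs \<open>(u, v)\<close>, \<open>(v, u)\<close>. Hence deleting
  an edge removes both arcs, and edges are counted as two-element sets. The strongly connected
  components (\<open>sccs\<close>) of such a symmetric digraph are its components as an undirected graph.
\<close>

definition del_edge :: "'a pair_pre_digraph \<Rightarrow> 'a \<Rightarrow> 'a \<Rightarrow> 'a pair_pre_digraph" where
  "del_edge G u v = G\<lparr>parcs := parcs G - {(u, v), (v, u)}\<rparr>"

definition cut_edges :: "'a pair_pre_digraph \<Rightarrow> 'a set set" where
  "cut_edges G =
     {{u, v} | u v. (u, v) \<in> parcs G \<and> card (pre_digraph.sccs (with_proj (del_edge G u v))) = 2}"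

definition graphs_with_cut_edges :: "nat \<Rightarrow> nat \<Rightarrow> 'a pair_pre_digraph set" where
  "graphs_with_cut_edges n k =
     {G. pair_graph G \<and> Digraph_Component.connected (with_proj G) \<and> card (pverts G) = n \<and>
         card (cut_edges G) = k}"

definition adj_matrix :: "'a pair_pre_digraph \<Rightarrow> 'a list \<Rightarrow> real mat" where
  "adj_matrix G vs =
     mat (length vs) (length vs) (\<lambda>(i, j). if (vs ! i, vs ! j) \<in> parcs G then 1 else 0)"

text \<open>
  Eigenvalues with algebraic multiplicity; since the matrix is real symmetric, all complex
  eigenvalues are among the real roots collected here. The choice of the vertex enumeration is
  irrelevant, see \<open>adj_spectrum_eq\<close> below.
\<close>

definition adj_spectrum :: "'a pair_pre_digraph \<Rightarrow> real multiset" where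
  "adj_spectrum G =
     proots (char_poly (adj_matrix G (SOME vs. distinct vs \<and> set vs = pverts G)))"

definition spectral_moment :: "nat \<Rightarrow> 'a pair_pre_digraph \<Rightarrow> real" where
  "spectral_moment i G = (\<Sum>x\<in>#adj_spectrum G. x ^ i)"

text \<open>The two graphs may have different vertex types.\<close>

definition S_less :: "'a pair_pre_digraph \<Rightarrow> 'b pair_pre_digraph \<Rightarrow> bool" (infix \<open>\<prec>\<^sub>s\<close> 50) where
  "G \<prec>\<^sub>s H \<longleftrightarrow> card (pverts G) = card (pverts H) \<and>
     (\<exists>j\<in>{1..card (pverts G) - 1}.
        (\<forall>i<j. spectral_moment i G = spectral_moment i H) \<and>
        spectral_moment j G < spectral_moment j H)"

text \<open>
  The cycle \<open>C\<^bsub>n-k\<^esub>\<close> on \<open>0, \<dots>, n-k-1\<close> and the path \<open>P\<^bsub>k+1\<^esub>\<close> on \<open>n-k-1, \<dots>, n-1\<close>, which share exactly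
  the vertex \<open>n-k-1\<close>. This is the intended graph when \<open>k + 3 \<le> n\<close>.
\<close>

definition cycle_with_tail :: "nat \<Rightarrow> nat \<Rightarrow> nat pair_pre_digraph" where
  "cycle_with_tail n k =
     (let E = {(i, Suc i mod (n - k)) | i. i < n - k} \<union> {(i, Suc i) | i. n - k - 1 \<le> i \<and> i < n - 1}
      in \<lparr>pverts = {0..<n}, parcs = E \<union> E\<inverse>\<rparr>)"

lemma char_poly_adj_matrix_cong:
  assumes "distinct vs" "distinct ws" "set vs = set ws"
  shows "char_poly (adj_matrix G vs) = char_poly (adj_matrix G ws)"
proof -
  define n where "n = length vs"
  have n': "length ws = n"
    using assms by (metis distinct_card n_def)
  have "mset ws = mset vs"
    using assms set_eq_iff_mset_eq_distinct by metis
  then obtain p where p: "p permutes {..<length vs}" "permute_list p vs = ws"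
    by (rule mset_eq_permutation)
  have p': "p permutes {0..<n}"
    using p(1) by (simp add: n_def lessThan_atLeast0)
  have ws: "ws ! i = vs ! p i" if "i < n" for i
    using p permute_list_nth[OF p(1)] that by (simp add: n_def)
  have pn: "p i < n" if "i < n" for i
    using permutes_in_image[OF p', of i] that by simp
  have pinj: "p i = p j \<longleftrightarrow> i = j" for i j
    using permutes_inj[OF p'] by (auto dest: injD)
  define A where "A = char_poly_matrix (adj_matrix G vs)"
  define R where "R = mat n n (\<lambda>(i, j). A $$ (p i, j))"
  have A: "A \<in> carrier_mat n n" and R: "R \<in> carrier_mat n n"
    by (auto simp: A_def R_def adj_matrix_def n_def char_poly_matrix_def)
  have "char_poly_matrix (adj_matrix G ws) = mat n n (\<lambda>(i, j). R\<^sup>T $$ (p j, i))"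
    by (rule eq_matI)
       (auto simp: char_poly_matrix_def R_def A_def adj_matrix_def n' n_def[symmetric] ws pn pinj)
  also have "\<dots> = (mat n n (\<lambda>(i, j). R\<^sup>T $$ (p i, j)))\<^sup>T"
    by (rule eq_matI) auto
  finally have "det (char_poly_matrix (adj_matrix G ws)) = signof p * det R\<^sup>T"
    using det_permute_rows[of "R\<^sup>T" n p] R p' by (simp add: det_transpose[of _ n])
  also have "\<dots> = signof p * (signof p * det A)"
    using det_permute_rows[OF A p'] R by (simp add: det_transpose[of _ n] R_def)
  also have "\<dots> = det A"
    by (simp add: sign_def)
  finally show ?thesis
    by (simp add: char_poly_def A_def)
qed

lemma adj_spectrum_eq:
  assumes "distinct vs" "set vs = pverts G"
  shows "adj_spectrum G = proots (char_poly (adj_matrix G vs))"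
proof -
  have "\<exists>vs. distinct vs \<and> set vs = pverts G"
    using assms by blast
  from someI_ex[OF this] show ?thesis
    unfolding adj_spectrum_def using assms
    by (intro arg_cong[where f = proots] char_poly_adj_matrix_cong) auto
qed

end

theory Submission
  imports Defs "Jordan_Normal_Form.Schur_Decomposition"
begin

text \<open>
  The moment \<open>S\<^sub>i\<close> is the trace of the \<open>i\<close>-th power of the adjacency matrix, hence the number of closed
  walks of length \<open>i\<close>. As \<open>S\<^sub>2\<close> is twice the number of edges and \<open>k < n - 1\<close> excludes trees, only
  unicyclic graphs compete. Peeling off leaves one at a time removes one cut edge per step, keeps
  the triangles and the 4-cycles, and ends in the cycle \<open>C\<^bsub>n-k\<^esub>\<close>. So all unicyclic candidates agree
  in \<open>S\<^sub>3\<close>, and their \<open>S\<^sub>4\<close> differ only by twice the sum of the squared degrees. A unicyclic graph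
  with at most one leaf is \<open>P\<^bsub>n\<^esub>\<^bsup>k\<^esup>\<close>, where this sum is at most \<open>4n + 2\<close>; two leaves force at least \<open>4n + 4\<close>,
  and they also force \<open>k \<ge> 2\<close>, so that \<open>S\<^sub>4\<close> is among the moments \<open>S\<^sub>0, \<dots>, S\<^bsub>n-1\<^esub>\<close>.
\<close>

section \<open>Power sums of the eigenvalues of a real symmetric matrix\<close>

lemma proots_prod_list_linear:
  fixes es :: "'a::idom list"
  shows "proots (\<Prod>e\<leftarrow>es. [:- e, 1:]) = mset es"
proof (induction es)
  case (Cons e es)
  have "monic (\<Prod>e\<leftarrow>es. [:- e, 1:])"
    by (rule monic_prod_list) auto
  then have "(\<Prod>e\<leftarrow>es. [:- e, 1:]) \<noteq> 0"
    by auto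
  then show ?case
    using Cons by (simp add: proots_mult del: mult_pCons_left)
qed simp

text \<open>Supplies the full list of real roots that the Schur decomposition takes as input. The
  fundamental theorem of algebra yields a complex root, which is real by hypothesis; splitting off
  its linear factor leaves a monic cofactor whose roots are again roots of \<open>p\<close>.\<close>

lemma real_poly_splits:
  fixes p :: "real poly"
  assumes "monic p" "\<And>z. poly (map_poly complex_of_real p) z = 0 \<Longrightarrow> z \<in> \<real>"
  shows "\<exists>es. p = (\<Prod>e\<leftarrow>es. [:- e, 1:])"
  using assms
proof (induction "degree p" arbitrary: p)
  case 0
  then have "p = 1"
    using monic_degree_0 by metis
  then show ?case
    by (intro exI[of _ "[]"]) auto
next
  case (Suc d)
  have "degree (map_poly complex_of_real p) = Suc d"
    using Suc.hyps(2) by (simp add: degree_map_poly)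
  then obtain z where z: "poly (map_poly complex_of_real p) z = 0"
    using fundamental_theorem_of_algebra[of "map_poly complex_of_real p"]
    by (metis constant_degree nat.distinct(1))
  then obtain r where "z = complex_of_real r"
    using Suc.prems(2) by (auto elim: Reals_cases)
  then have "poly p r = 0"
    using z by (metis of_real_eq_0_iff of_real_hom.poly_map_poly)
  then obtain q where q: "p = [:- r, 1:] * q"
    using poly_eq_0_iff_dvd by (metis dvd_def)
  have "q \<noteq> 0"
    using q Suc.hyps(2) by auto
  then have deg: "degree q = d"
    using q Suc.hyps(2) degree_mult_eq[of "[:- r, 1:]" q] by simp
  have "monic q"
    using Suc.prems(1) lead_coeff_mult[of "[:- r, 1:]" q] q by simp
  moreover have "z \<in> \<real>" if "poly (map_poly complex_of_real q) z = 0" for z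
  proof -
    interpret h: map_poly_comm_ring_hom complex_of_real ..
    show ?thesis
      using Suc.prems(2)[of z] that unfolding q h.hom_mult by simp
  qed
  ultimately obtain es where "q = (\<Prod>e\<leftarrow>es. [:- e, 1:])"
    using Suc.hyps(1)[of q] deg by auto
  then show ?case
    using q by (intro exI[of _ "r # es"]) simp
qed

text \<open>For an eigenvector \<open>v\<close> the Hermitian form \<open>s\<close> equals
  \<open>z\<close> times the squared norm of \<open>v\<close>. By symmetry of \<open>A\<close>,
  conjugation only exchanges the two summation indices, so \<open>s\<close> is real, and the squared
  norm is real and nonzero.\<close>

lemma eigenvalue_real_symmetric:
  fixes A :: "real mat"
  assumes A: "A \<in> carrier_mat n n" and sym: "\<And>i j. i < n \<Longrightarrow> j < n \<Longrightarrow> A $$ (i, j) = A $$ (j, i)"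
    and ev: "eigenvalue (map_mat complex_of_real A) z"
  shows "z \<in> \<real>"
proof -
  let ?B = "map_mat complex_of_real A"
  obtain v where v: "v \<in> carrier_vec n" "v \<noteq> 0\<^sub>v n" "?B *\<^sub>v v = z \<cdot>\<^sub>v v"
    using ev A unfolding eigenvalue_def eigenvector_def by auto
  define s where "s = (\<Sum>i<n. \<Sum>j<n. cnj (v $ i) * of_real (A $$ (i, j)) * v $ j)"
  have "(\<Sum>j<n. of_real (A $$ (i, j)) * v $ j) = z * v $ i" if "i < n" for i
  proof -
    have "(?B *\<^sub>v v) $ i = (\<Sum>j<n. of_real (A $$ (i, j)) * v $ j)"
      using that A v(1) by (simp add: scalar_prod_def lessThan_atLeast0)
    then show ?thesis
      using that v by simp
  qed
  then have "s = (\<Sum>i<n. cnj (v $ i) * (z * v $ i))"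
    unfolding s_def by (intro sum.cong) (auto simp: mult.assoc simp flip: sum_distrib_left)
  also have "\<dots> = z * of_real (\<Sum>i<n. (cmod (v $ i))\<^sup>2)"
    by (simp add: sum_distrib_left mult_ac flip: complex_norm_square)
  finally have s: "s = z * of_real (\<Sum>i<n. (cmod (v $ i))\<^sup>2)" .
  have "cnj s = (\<Sum>i<n. \<Sum>j<n. cnj (v $ j) * of_real (A $$ (j, i)) * v $ i)"
    unfolding s_def using sym by (auto simp: mult_ac intro!: sum.cong)
  also have "\<dots> = s"
    unfolding s_def by (rule sum.swap)
  finally have "s \<in> \<real>"
    by (simp add: Reals_cnj_iff)
  moreover have "(\<Sum>i<n. (cmod (v $ i))\<^sup>2) \<noteq> 0"
  proof
    assume "(\<Sum>i<n. (cmod (v $ i))\<^sup>2) = 0"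
    then have "\<forall>i<n. v $ i = 0"
      by (simp add: sum_nonneg_eq_0_iff)
    then have "v = 0\<^sub>v n"
      using v(1) by (intro eq_vecI) auto
    then show False
      using v(2) by simp
  qed
  ultimately show ?thesis
    using s by (metis Reals_divide Reals_of_real nonzero_mult_div_cancel_right of_real_eq_0_iff)
qed

definition mat_trace :: "'a::comm_monoid_add mat \<Rightarrow> 'a" where
  "mat_trace A = (\<Sum>i<dim_row A. A $$ (i, i))"

lemma mat_trace_mult_commute:
  fixes A B :: "'a::comm_semiring_0 mat"
  assumes "A \<in> carrier_mat n n" "B \<in> carrier_mat n n"
  shows "mat_trace (A * B) = mat_trace (B * A)"
proof -
  have "mat_trace (A * B) = (\<Sum>i<n. \<Sum>j<n. A $$ (i, j) * B $$ (j, i))"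
    using assms by (auto simp: mat_trace_def scalar_prod_def lessThan_atLeast0)
  also have "\<dots> = (\<Sum>j<n. \<Sum>i<n. B $$ (j, i) * A $$ (i, j))"
    by (subst sum.swap) (simp add: mult.commute)
  also have "\<dots> = mat_trace (B * A)"
    using assms by (auto simp: mat_trace_def scalar_prod_def lessThan_atLeast0)
  finally show ?thesis .
qed

lemma mat_trace_similar:
  fixes A :: "'a::comm_ring_1 mat"
  assumes A: "A \<in> carrier_mat n n" and wit: "similar_mat_wit A B P Q"
  shows "mat_trace A = mat_trace B"
proof -
  note w = similar_mat_witD2[OF A wit]
  have "mat_trace A = mat_trace (P * (B * Q))"
    using w by (simp add: assoc_mult_mat[of _ n n _ n _ n])
  also have "\<dots> = mat_trace (B * Q * P)"
    using w by (intro mat_trace_mult_commute[of _ n]) auto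
  also have "B * Q * P = B"
    using w by (simp add: assoc_mult_mat[of _ n n _ n _ n])
  finally show ?thesis .
qed

text \<open>Both claims share one induction: a diagonal entry of \<open>?C * B\<close> collapses to
  a single product because the entries below the diagonal vanish in both factors.\<close>

lemma upper_triangular_pow:
  fixes B :: "'a::comm_ring_1 mat"
  assumes B: "B \<in> carrier_mat n n" and ut: "upper_triangular B"
  shows "(\<forall>i<n. \<forall>j<i. (B ^\<^sub>m k) $$ (i, j) = 0) \<and> (\<forall>i<n. (B ^\<^sub>m k) $$ (i, i) = (B $$ (i, i)) ^ k)"
proof (induction k)
  case 0
  then show ?case using B by auto
next
  case (Suc k)
  let ?C = "B ^\<^sub>m k"
  have C: "?C \<in> carrier_mat n n" using B by simp
  have entry: "(?C * B) $$ (i, j) = (\<Sum>l<n. ?C $$ (i, l) * B $$ (l, j))" if "i < n" "j < n" for i j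
    using that B C by (auto simp: scalar_prod_def lessThan_atLeast0)
  have B0: "B $$ (i, j) = 0" if "i < n" "j < i" for i j
    using ut that B by auto
  have "(?C * B) $$ (i, j) = 0" if "i < n" "j < i" for i j
  proof -
    have "?C $$ (i, l) * B $$ (l, j) = 0" if "l < n" for l
      using that \<open>i < n\<close> \<open>j < i\<close> Suc B0[of l j] by (cases "l < i") auto
    then show ?thesis using that entry by simp
  qed
  moreover have "(?C * B) $$ (i, i) = (B $$ (i, i)) ^ Suc k" if "i < n" for i
  proof -
    have "?C $$ (i, l) * B $$ (l, i) = 0" if "l < n" "l \<noteq> i" for l
      using that \<open>i < n\<close> Suc B0[of l i] by (cases "l < i") auto
    then have "(\<Sum>l<n. ?C $$ (i, l) * B $$ (l, i)) = (\<Sum>l\<in>{i}. ?C $$ (i, l) * B $$ (l, i))"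
      using that by (intro sum.mono_neutral_right) auto
    then show ?thesis using that entry Suc by (simp add: mult.commute)
  qed
  ultimately show ?case by simp
qed

text \<open>All roots are real, so a Schur decomposition over the reals exists and carries exactly
  these roots on the diagonal of a triangular \<open>B\<close>. The trace of a power of
  \<open>B\<close> is the power sum of that diagonal, and similarity preserves traces of
  powers.\<close>

lemma sum_proots_real_symmetric:
  fixes A :: "real mat"
  assumes A: "A \<in> carrier_mat n n" and sym: "\<And>i j. i < n \<Longrightarrow> j < n \<Longrightarrow> A $$ (i, j) = A $$ (j, i)"
  shows "(\<Sum>x\<in>#proots (char_poly A). x ^ k) = mat_trace (A ^\<^sub>m k)"
proof -
  have "z \<in> \<real>" if "poly (map_poly complex_of_real (char_poly A)) z = 0" for z
    using that eigenvalue_real_symmetric[OF A sym] A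
    by (subst (asm) of_real_hom.char_poly_hom[symmetric, OF A])
       (simp add: eigenvalue_root_char_poly[of _ n])
  then obtain es where es: "char_poly A = (\<Prod>e\<leftarrow>es. [:- e, 1:])"
    using real_poly_splits[of "char_poly A"] degree_monic_char_poly[OF A] by auto
  obtain B P Q where "schur_decomposition A es = (B, P, Q)"
    using prod_cases3 by blast
  from schur_decomposition[OF A es this]
  have wit: "similar_mat_wit A B P Q" and ut: "upper_triangular B" and diag: "diag_mat B = es"
    by auto
  have B: "B \<in> carrier_mat n n"
    using similar_mat_witD2[OF A wit] by simp
  have "proots (char_poly A) = mset es"
    unfolding es by (rule proots_prod_list_linear)
  then have "(\<Sum>x\<in>#proots (char_poly A). x ^ k) = (\<Sum>x\<leftarrow>es. x ^ k)"
    by (metis mset_map sum_mset_sum_list)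
  also have "\<dots> = (\<Sum>i<n. (B $$ (i, i)) ^ k)"
    using B by (simp add: diag[symmetric] diag_mat_def comp_def interv_sum_list_conv_sum_set_nat lessThan_atLeast0)
  also have "\<dots> = mat_trace (B ^\<^sub>m k)"
    using B upper_triangular_pow[OF B ut] by (simp add: mat_trace_def)
  also have "\<dots> = mat_trace (A ^\<^sub>m k)"
    using A mat_trace_similar[OF _ similar_mat_wit_pow[OF wit, of k], of n] by simp
  finally show ?thesis .
qed

section \<open>Connected graphs as symmetric relations\<close>

text \<open>A bare vertex set with a symmetric relation makes deleting vertices and edges cheap.
  Each undirected edge contributes two pairs, so \<open>card E\<close> is twice the number of
  edges.\<close>

locale conn_graph =
  fixes V :: "'a set" and E :: "'a rel"
  assumes finite_V: "finite V" and nonempty: "V \<noteq> {}" and E_subset: "E \<subseteq> V \<times> V"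
    and sym_E: "sym E" and irrefl_E: "irrefl E"
    and connected: "\<And>x y. x \<in> V \<Longrightarrow> y \<in> V \<Longrightarrow> (x, y) \<in> E\<^sup>*"

definition deg :: "'a rel \<Rightarrow> 'a \<Rightarrow> nat" where
  "deg E x = card (E `` {x})"

definition remove_edge :: "'a rel \<Rightarrow> 'a \<Rightarrow> 'a \<Rightarrow> 'a rel" where
  "remove_edge E x y = E - {(x, y), (y, x)}"

text \<open>Cut edges described through reachability of the two ends instead of a count of
  components; \<open>cut_edges_eq_bridges\<close> shows that the two notions agree on connected
  graphs.\<close>

definition bridges :: "'a rel \<Rightarrow> 'a set set" where
  "bridges E = {{x, y} | x y. (x, y) \<in> E \<and> (x, y) \<notin> (remove_edge E x y)\<^sup>*}"

definition triangles :: "'a rel \<Rightarrow> ('a \<times> 'a \<times> 'a) set" where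
  "triangles E = {(x, y, z). (x, y) \<in> E \<and> (y, z) \<in> E \<and> (z, x) \<in> E}"

text \<open>For an irreflexive symmetric \<open>E\<close> these are the 4-cycles with a starting
  point and a direction, so each 4-cycle occurs eight times; likewise each triangle occurs six times
  in \<open>triangles\<close>.\<close>

definition quads :: "'a rel \<Rightarrow> ('a \<times> 'a \<times> 'a \<times> 'a) set" where
  "quads E = {(a, b, c, d). (a, b) \<in> E \<and> (b, c) \<in> E \<and> (c, d) \<in> E \<and> (d, a) \<in> E \<and> a \<noteq> c \<and> b \<noteq> d}"

lemma remove_edge_commute: "remove_edge E x y = remove_edge E y x"
  by (auto simp: remove_edge_def)

lemma sym_remove_edge: "sym E \<Longrightarrow> sym (remove_edge E x y)"
  by (auto simp: remove_edge_def sym_def)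

lemma rtrancl_sym: "sym E \<Longrightarrow> (x, y) \<in> E\<^sup>* \<Longrightarrow> (y, x) \<in> E\<^sup>*"
  using sym_rtrancl by (metis symD)

text \<open>A walk can enter and leave \<open>v\<close> only through \<open>u\<close>, so every
  visit to \<open>v\<close> is a detour that can be cut out. Redirecting an end at \<open>v\<close>
  to \<open>u\<close> gives an invariant that also covers walks currently standing at
  \<open>v\<close>.\<close>

lemma rtrancl_avoid_leaf:
  assumes "(x, y) \<in> E\<^sup>*" "x \<noteq> v" "\<And>w. (w, v) \<in> E \<Longrightarrow> w = u" "\<And>w. (v, w) \<in> E \<Longrightarrow> w = u"
  shows "(x, if y = v then u else y) \<in> (remove_edge E u v)\<^sup>*"
  using assms(1)
proof (induction rule: rtrancl_induct)
  case base
  then show ?case using assms(2) by simp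
next
  case (step y z)
  consider "z = v" | "y = v" "z \<noteq> v" | "y \<noteq> v" "z \<noteq> v" by blast
  then show ?case
  proof cases
    case 1
    then have "y = u" using step(2) assms(3) by simp
    then show ?thesis using step(3) 1 by (auto split: if_splits)
  next
    case 2
    then show ?thesis using step(2,3) assms(4) by auto
  next
    case 3
    then have "(y, z) \<in> remove_edge E u v"
      using step(2) by (auto simp: remove_edge_def)
    then show ?thesis using 3 step(3) by (auto intro: rtrancl_into_rtrancl)
  qed
qed

lemma bridges_sym_iff:
  assumes "sym E"
  shows "{x, y} \<in> bridges E \<longleftrightarrow> (x, y) \<in> E \<and> (x, y) \<notin> (remove_edge E x y)\<^sup>*"
proof
  assume "{x, y} \<in> bridges E"
  then obtain a b where ab: "{x, y} = {a, b}" "(a, b) \<in> E" "(a, b) \<notin> (remove_edge E a b)\<^sup>*"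
    unfolding bridges_def by blast
  then consider "x = a" "y = b" | "x = b" "y = a"
    by (auto simp: doubleton_eq_iff)
  then show "(x, y) \<in> E \<and> (x, y) \<notin> (remove_edge E x y)\<^sup>*"
  proof cases
    case 2
    then show ?thesis
      using ab assms rtrancl_sym[OF sym_remove_edge[OF assms]]
      by (metis remove_edge_commute symD)
  qed (use ab in auto)
qed (auto simp: bridges_def)

context conn_graph
begin

lemma finite_E: "finite E"
  using finite_V E_subset by (meson finite_SigmaI finite_subset)

lemma finite_nbrs: "finite (E `` {x})"
  using finite_E by (rule finite_Image) 

lemma symE: "(x, y) \<in> E \<Longrightarrow> (y, x) \<in> E"
  using sym_E by (rule symD)

lemma no_loop: "(x, x) \<notin> E"
  using irrefl_E by (auto simp: irrefl_def)

lemma in_V: "(x, y) \<in> E \<Longrightarrow> x \<in> V" "(x, y) \<in> E \<Longrightarrow> y \<in> V"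
  using E_subset by auto

lemma sum_deg: "(\<Sum>x\<in>V. deg E x) = card E"
proof -
  have "E = (SIGMA x:V. E `` {x})"
    using in_V by auto
  then have "card E = card (SIGMA x:V. E `` {x})"
    by simp
  then show ?thesis
    using finite_V finite_nbrs by (simp add: deg_def)
qed

lemma deg_ge_1:
  assumes "x \<in> V" "card V \<ge> 2"
  shows "deg E x \<ge> 1"
proof -
  obtain y where y: "y \<in> V" "y \<noteq> x"
    using assms by (metis card_1_singleton_iff card_le_Suc0_iff_eq finite_V not_less_eq_eq numeral_2_eq_2)
  then have "(x, y) \<in> E\<^sup>*" using connected assms by simp
  then have "E `` {x} \<noteq> {}"
    using y(2) by (auto elim: converse_rtranclE)
  then show ?thesis
    using finite_nbrs by (simp add: deg_def Suc_leI card_gt_0_iff)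
qed

end

section \<open>Deleting a leaf, and its consequences for edge counts and bridges\<close>

locale conn_graph_leaf = conn_graph +
  fixes v u
  assumes v_in: "v \<in> V" and nbrs_v: "E `` {v} = {u}"
begin

abbreviation "E' \<equiv> remove_edge E u v"

lemma uv: "(u, v) \<in> E" "(v, u) \<in> E" "u \<noteq> v" "u \<in> V"
proof -
  have "u \<in> E `` {v}" unfolding nbrs_v by simp
  then show "(v, u) \<in> E" by simp
  then show "(u, v) \<in> E" "u \<noteq> v" "u \<in> V" using symE no_loop in_V by auto
qed

lemma leaf_iff: "(v, w) \<in> E \<longleftrightarrow> w = u" "(w, v) \<in> E \<longleftrightarrow> w = u"
proof -
  show r: "(v, w) \<in> E \<longleftrightarrow> w = u" for w
  proof -
    have "(v, w) \<in> E \<longleftrightarrow> w \<in> E `` {v}" by simp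
    then show ?thesis unfolding nbrs_v by simp
  qed
  show "(w, v) \<in> E \<longleftrightarrow> w = u"
    unfolding r[symmetric] using symE by metis
qed

lemma E'_iff: "(x, y) \<in> E' \<longleftrightarrow> (x, y) \<in> E \<and> x \<noteq> v \<and> y \<noteq> v"
  using uv(3) by (auto simp: remove_edge_def leaf_iff)

lemma E_eq: "E = E' \<union> {(u, v), (v, u)}"
  using uv by (auto simp: remove_edge_def)

text \<open>Walks between the remaining vertices can avoid the leaf, so connectedness survives. This
  is what allows the later inductions on the number of vertices.\<close>

sublocale peel: conn_graph "V - {v}" E'
proof
  show "finite (V - {v})" using finite_V by simp
  show "V - {v} \<noteq> {}" using uv by auto
  show "E' \<subseteq> (V - {v}) \<times> (V - {v})" using in_V by (auto simp: E'_iff)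
  show "sym E'" using sym_E by (rule sym_remove_edge)
  show "irrefl E'" using no_loop by (auto simp: irrefl_def E'_iff)
  show "(x, y) \<in> E'\<^sup>*" if "x \<in> V - {v}" "y \<in> V - {v}" for x y
  proof -
    have "(x, if y = v then u else y) \<in> E'\<^sup>*"
      by (rule rtrancl_avoid_leaf) (use that connected in \<open>auto simp: leaf_iff\<close>)
    then show ?thesis using that by simp
  qed
qed

lemma card_V_peel: "card V = Suc (card (V - {v}))"
  using finite_V v_in by (metis card_Suc_Diff1)

lemma card_E_peel: "card E = card E' + 2"
proof -
  have "card E = card (E' \<union> {(u, v), (v, u)})"
    using E_eq by simp
  also have "\<dots> = card E' + card {(u, v), (v, u)}"
    using finite_E by (intro card_Un_disjoint) (auto simp: remove_edge_def)
  finally show ?thesis using uv by simp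
qed

lemma deg_peel_other: "x \<noteq> u \<Longrightarrow> x \<noteq> v \<Longrightarrow> deg E' x = deg E x"
proof -
  assume "x \<noteq> u" "x \<noteq> v"
  then have "E' `` {x} = E `` {x}" by (auto simp: remove_edge_def)
  then show ?thesis by (simp add: deg_def)
qed

lemma deg_peel_nbr: "deg E u = Suc (deg E' u)"
proof -
  have "E `` {u} = insert v (E' `` {u})" "v \<notin> E' `` {u}"
    using uv by (auto simp: remove_edge_def)
  then show ?thesis
    using peel.finite_nbrs by (simp add: deg_def)
qed

text \<open>The pendant edge is a bridge because \<open>v\<close> is isolated in \<open>E'\<close>.
  For any other edge, a walk that bypasses it can also be made to avoid \<open>v\<close>, so its
  status does not change.\<close>

lemma bridges_peel: "bridges E = insert {u, v} (bridges E')" "{u, v} \<notin> bridges E'"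
proof -
  have E'': "remove_edge E' x y = remove_edge (remove_edge E x y) u v" for x y
    by (auto simp: remove_edge_def)
  have "{u, v} \<in> bridges E"
  proof -
    have "(v, u) \<notin> E'\<^sup>*"
    proof
      assume "(v, u) \<in> E'\<^sup>*"
      then show False
        by (cases rule: converse_rtranclE) (use uv(3) in \<open>auto simp: E'_iff\<close>)
    qed
    then have "(u, v) \<notin> E'\<^sup>*"
      using rtrancl_sym[OF peel.sym_E] by blast
    then show ?thesis
      using uv by (simp add: bridges_sym_iff sym_E)
  qed
  moreover have "(x, y) \<in> (remove_edge E x y)\<^sup>* \<longleftrightarrow> (x, y) \<in> (remove_edge E' x y)\<^sup>*"
    if "(x, y) \<in> E'" for x y
  proof
    assume xy_reach: "(x, y) \<in> (remove_edge E x y)\<^sup>*"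
    have xy: "x \<noteq> v" "y \<noteq> v" using that E'_iff by auto
    from xy_reach xy(1) have "(x, if y = v then u else y) \<in> (remove_edge (remove_edge E x y) u v)\<^sup>*"
      by (rule rtrancl_avoid_leaf) (auto simp: remove_edge_def leaf_iff)
    then show "(x, y) \<in> (remove_edge E' x y)\<^sup>*"
      using xy by (simp add: E'')
  next
    assume "(x, y) \<in> (remove_edge E' x y)\<^sup>*"
    then show "(x, y) \<in> (remove_edge E x y)\<^sup>*"
      by (rule rtrancl_mono[THEN subsetD, rotated]) (auto simp: remove_edge_def)
  qed
  moreover have "(x, y) \<in> E' \<or> {x, y} = {u, v}" if "(x, y) \<in> E" for x y
    using that by (auto simp: remove_edge_def)
  moreover have "(x, y) \<in> E' \<Longrightarrow> (x, y) \<in> E" for x y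
    by (simp add: E'_iff)
  ultimately show "bridges E = insert {u, v} (bridges E')"
    unfolding bridges_def by blast
  show "{u, v} \<notin> bridges E'"
    by (auto simp: bridges_sym_iff peel.sym_E E'_iff)
qed

end

context conn_graph
begin

lemma finite_bridges: "finite (bridges E)"
proof (rule finite_subset)
  show "bridges E \<subseteq> Pow V" using in_V by (auto simp: bridges_def)
qed (simp add: finite_V)

lemma leaf_if_deg_1:
  assumes "x \<in> V" "deg E x = 1"
  obtains u where "conn_graph_leaf V E x u"
proof -
  obtain u where "E `` {x} = {u}"
    using assms(2) by (auto simp: deg_def card_1_singleton_iff)
  with assms(1) show thesis
    by (intro that) unfold_locales
qed

end

context conn_graph_leaf
begin

lemma card_bridges_peel: "card (bridges E) = Suc (card (bridges E'))"
  using bridges_peel peel.finite_bridges by simp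

text \<open>On a triangle through \<open>v\<close> both neighbours of \<open>v\<close> would be
  \<open>u\<close>, which gives a loop at \<open>u\<close>. On a 4-cycle through \<open>v\<close>
  two opposite vertices would both be \<open>u\<close>, which settles \<open>quads_peel\<close> in
  the same way.\<close>

lemma triangles_peel: "triangles E' = triangles E"
proof -
  have "(v, y, z) \<notin> triangles E" "(y, v, z) \<notin> triangles E" "(y, z, v) \<notin> triangles E" for y z
    using no_loop by (auto simp: triangles_def leaf_iff)
  then have "x \<noteq> v \<and> y \<noteq> v \<and> z \<noteq> v" if "(x, y, z) \<in> triangles E" for x y z
    using that by metis
  then show ?thesis
    unfolding triangles_def E'_iff by blast
qed

lemma quads_peel: "quads E' = quads E"
proof -
  have "(v, b, c, d) \<notin> quads E" "(b, v, c, d) \<notin> quads E" "(b, c, v, d) \<notin> quads E"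
    "(b, c, d, v) \<notin> quads E" for b c d
    by (auto simp: quads_def leaf_iff)
  then have "a \<noteq> v \<and> b \<noteq> v \<and> c \<noteq> v \<and> d \<noteq> v" if "(a, b, c, d) \<in> quads E" for a b c d
    using that by metis
  then show ?thesis
    unfolding quads_def E'_iff by blast
qed

end

text \<open>The hypothesis says that there are fewer edges than vertices. Then the average degree is
  below 2, so there is a leaf to peel off, and the induction shows that the graph is a tree in which
  every edge is a bridge.\<close>

lemma (in conn_graph) few_edges:
  assumes "card E < 2 * card V"
  shows "card E = 2 * card V - 2 \<and> card (bridges E) = card V - 1"
  using assms conn_graph_axioms
proof (induction "card V" arbitrary: V E)
  case 0
  interpret conn_graph V E by fact
  show ?case using 0 finite_V nonempty by simp
next
  case (Suc m)
  interpret conn_graph V E by fact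
  show ?case
  proof (cases "m = 0")
    case True
    then obtain x where "V = {x}"
      using Suc.hyps(2) by (metis One_nat_def card_1_singleton_iff)
    then have "E = {}"
      using E_subset no_loop by auto
    moreover then have "bridges E = {}"
      by (auto simp: bridges_def)
    ultimately show ?thesis
      using Suc.hyps(2) True by simp
  next
    case False
    have "\<exists>x\<in>V. deg E x < 2"
    proof (rule ccontr)
      assume "\<not> ?thesis"
      then have "(\<Sum>x\<in>V. 2) \<le> (\<Sum>x\<in>V. deg E x)"
        by (intro sum_mono) auto
      then show False
        using Suc.prems(1) sum_deg by simp
    qed
    then obtain x where x: "x \<in> V" "deg E x < 2" by blast
    then have "deg E x = 1"
      using deg_ge_1[of x] False Suc.hyps(2) by simp
    then obtain u where "conn_graph_leaf V E x u"
      using leaf_if_deg_1 x by blast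
    then interpret conn_graph_leaf V E x u .
    have "card E' = 2 * card (V - {x}) - 2 \<and> card (bridges E') = card (V - {x}) - 1"
      using Suc.prems(1) card_E_peel card_V_peel Suc.hyps(2)
      by (intro Suc.hyps(1) peel.conn_graph_axioms) auto
    then show ?thesis
      using card_E_peel card_V_peel card_bridges_peel Suc.hyps(2) False by auto
  qed
qed

text \<open>Suppose \<open>uv\<close> is a bridge and let \<open>A\<close> be the component of
  \<open>u\<close> after its deletion. There \<open>u\<close> has degree 1 and all other vertices
  keep degree 2, so \<open>H\<close> has \<open>2 * card A - 1\<close> pairs. This is few enough for
  \<open>few_edges\<close>, which demands \<open>2 * card A - 2\<close>.\<close>

lemma (in conn_graph) two_regular_no_bridges:
  assumes "\<And>x. x \<in> V \<Longrightarrow> deg E x = 2"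
  shows "bridges E = {}"
proof (rule ccontr)
  assume "bridges E \<noteq> {}"
  then obtain u v where uv: "(u, v) \<in> E" "(u, v) \<notin> (remove_edge E u v)\<^sup>*"
    by (auto simp: bridges_def)
  define F where "F = remove_edge E u v"
  define A where "A = {x. (u, x) \<in> F\<^sup>*}"
  have FE: "F \<subseteq> E" by (auto simp: F_def remove_edge_def)
  have symF: "sym F" unfolding F_def by (rule sym_remove_edge[OF sym_E])
  have A: "u \<in> A" "v \<notin> A" using uv by (auto simp: A_def F_def)
  have clos: "x \<in> A \<Longrightarrow> (x, y) \<in> F \<Longrightarrow> y \<in> A" for x y
    by (auto simp: A_def intro: rtrancl_into_rtrancl)
  have "A \<subseteq> V"
  proof
    fix x assume "x \<in> A"
    then have "(u, x) \<in> F\<^sup>*" by (simp add: A_def)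
    then show "x \<in> V" using uv(1) in_V FE by (induction rule: rtrancl_induct) auto
  qed
  define H where "H = F \<inter> A \<times> A"
  have H: "(x, y) \<in> H \<longleftrightarrow> x \<in> A \<and> (x, y) \<in> F" for x y
    using clos by (auto simp: H_def)
  have reach: "(u, x) \<in> H\<^sup>*" if "x \<in> A" for x
  proof -
    have "(u, x) \<in> F\<^sup>*" using that by (simp add: A_def)
    then have "(u, x) \<in> H\<^sup>* \<and> x \<in> A"
      by (induction rule: rtrancl_induct) (use A clos H in \<open>auto intro: rtrancl_into_rtrancl\<close>)
    then show ?thesis by simp
  qed
  have symH: "sym H"
    using symF by (auto simp: H_def sym_def)
  interpret H: conn_graph A H
  proof
    show "finite A" using \<open>A \<subseteq> V\<close> finite_V finite_subset by blast
    show "A \<noteq> {}" using A by blast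
    show "H \<subseteq> A \<times> A" by (auto simp: H_def)
    show "sym H" by (rule symH)
    show "irrefl H" using no_loop FE by (auto simp: H_def irrefl_def)
    show "(x, y) \<in> H\<^sup>*" if "x \<in> A" "y \<in> A" for x y
      using reach[OF that(1)] reach[OF that(2)] rtrancl_sym[OF symH] by (meson rtrancl_trans)
  qed
  have "E `` {u} = insert v (H `` {u})" "v \<notin> H `` {u}"
    using A uv(1) H by (auto simp: F_def remove_edge_def)
  then have "deg E u = Suc (deg H u)"
    using H.finite_nbrs by (simp add: deg_def)
  then have degu: "deg H u = 1"
    using assms uv(1) in_V by fastforce
  have "deg H x = 2" if "x \<in> A - {u}" for x
  proof -
    have "H `` {x} = E `` {x}"
      using that A H by (auto simp: F_def remove_edge_def)
    then show ?thesis using that assms \<open>A \<subseteq> V\<close> by (auto simp: deg_def)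
  qed
  then have "(\<Sum>x\<in>A - {u}. deg H x) = 2 * card (A - {u})"
    by simp
  then have "card H = 2 * card (A - {u}) + 1"
    using degu sum.remove[OF H.finite_V A(1), of "deg H"] H.sum_deg by simp
  moreover have "card A = Suc (card (A - {u}))"
    using A(1) H.finite_V by (metis card_Suc_Diff1)
  ultimately show False
    using H.few_edges by simp
qed

section \<open>Paths, cycles and cycles with a tail\<close>

definition rel_iso :: "('a \<Rightarrow> 'b) \<Rightarrow> 'a set \<Rightarrow> 'a rel \<Rightarrow> 'b set \<Rightarrow> 'b rel \<Rightarrow> bool" where
  "rel_iso f V E W F \<longleftrightarrow> bij_betw f V W \<and> (\<forall>x\<in>V. \<forall>y\<in>V. (f x, f y) \<in> F \<longleftrightarrow> (x, y) \<in> E)"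

definition path_rel :: "nat \<Rightarrow> nat rel" where
  "path_rel n = {(x, y). x < n \<and> y < n \<and> (y = Suc x \<or> x = Suc y)}"

text \<open>The cycle with a tail, written as a spanning path on all \<open>n\<close> vertices plus
  the one edge that closes the cycle on the first \<open>m\<close> of them. In this form lengthening
  the tail adds a single edge at the last vertex.\<close>

definition lasso :: "nat \<Rightarrow> nat \<Rightarrow> nat rel" where
  "lasso n m = path_rel n \<union> {(m - 1, 0), (0, m - 1)}"

lemma path_rel_Suc: "m > 0 \<Longrightarrow> path_rel (Suc m) = path_rel m \<union> {(m - 1, m), (m, m - 1)}"
  by (auto simp: path_rel_def)

lemma lasso_Suc: "n > 0 \<Longrightarrow> lasso (Suc n) m = lasso n m \<union> {(n - 1, n), (n, n - 1)}"
  unfolding lasso_def path_rel_Suc by auto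

lemma lasso_subset: "0 < m \<Longrightarrow> m \<le> n \<Longrightarrow> lasso n m \<subseteq> {0..<n} \<times> {0..<n}"
  by (auto simp: lasso_def path_rel_def)

section \<open>Isomorphisms onto paths and cycles\<close>

lemma card_triangles_iso:
  assumes "rel_iso f V E W F" "E \<subseteq> V \<times> V" "F \<subseteq> W \<times> W"
  shows "card (triangles E) = card (triangles F)"
proof (rule bij_betw_same_card)
  let ?g = "map_prod f (map_prod f f)"
  have inj: "inj_on f V" and W: "W = f ` V" and iff: "\<And>x y. x \<in> V \<Longrightarrow> y \<in> V \<Longrightarrow> (f x, f y) \<in> F \<longleftrightarrow> (x, y) \<in> E"
    using assms(1) by (auto simp: rel_iso_def bij_betw_def)
  have sub: "triangles E \<subseteq> V \<times> V \<times> V"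
    using assms(2) by (auto simp: triangles_def)
  show "bij_betw ?g (triangles E) (triangles F)"
    unfolding bij_betw_def
  proof
    show "inj_on ?g (triangles E)"
      by (rule inj_on_subset[OF _ sub]) (intro map_prod_inj_on inj)
    show "?g ` triangles E = triangles F"
    proof (intro equalityI subsetI)
      fix t assume "t \<in> ?g ` triangles E"
      then obtain x y z where xyz: "(x, y, z) \<in> triangles E" "t = (f x, f y, f z)"
        by auto
      moreover have "x \<in> V" "y \<in> V" "z \<in> V" using xyz(1) sub by auto
      ultimately show "t \<in> triangles F"
        by (simp add: triangles_def iff)
    next
      fix t assume t: "t \<in> triangles F"
      then have "t \<in> W \<times> W \<times> W"
        using assms(3) by (auto simp: triangles_def)
      then obtain x y z where xyz: "x \<in> V" "y \<in> V" "z \<in> V" "t = (f x, f y, f z)"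
        unfolding W by auto
      then have "(x, y, z) \<in> triangles E"
        using t by (simp add: triangles_def iff)
      then show "t \<in> ?g ` triangles E"
        using xyz by force
    qed
  qed
qed

lemma card_quads_iso:
  assumes "rel_iso f V E W F" "E \<subseteq> V \<times> V" "F \<subseteq> W \<times> W"
  shows "card (quads E) = card (quads F)"
proof (rule bij_betw_same_card)
  let ?g = "map_prod f (map_prod f (map_prod f f))"
  have inj: "inj_on f V" and W: "W = f ` V" and iff: "\<And>x y. x \<in> V \<Longrightarrow> y \<in> V \<Longrightarrow> (f x, f y) \<in> F \<longleftrightarrow> (x, y) \<in> E"
    using assms(1) by (auto simp: rel_iso_def bij_betw_def)
  have eq: "f x = f y \<longleftrightarrow> x = y" if "x \<in> V" "y \<in> V" for x y
    using inj that by (auto dest: inj_onD)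
  have sub: "quads E \<subseteq> V \<times> V \<times> V \<times> V"
    using assms(2) by (auto simp: quads_def)
  show "bij_betw ?g (quads E) (quads F)"
    unfolding bij_betw_def
  proof
    show "inj_on ?g (quads E)"
      by (rule inj_on_subset[OF _ sub]) (intro map_prod_inj_on inj)
    show "?g ` quads E = quads F"
    proof (intro equalityI subsetI)
      fix t assume "t \<in> ?g ` quads E"
      then obtain a b c d where abcd: "(a, b, c, d) \<in> quads E" "t = (f a, f b, f c, f d)"
        by auto
      moreover have "a \<in> V" "b \<in> V" "c \<in> V" "d \<in> V" using abcd(1) sub by auto
      ultimately show "t \<in> quads F"
        by (simp add: quads_def iff eq)
    next
      fix t assume t: "t \<in> quads F"
      then have "t \<in> W \<times> W \<times> W \<times> W"
        using assms(3) by (auto simp: quads_def)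
      then obtain a b c d where abcd: "a \<in> V" "b \<in> V" "c \<in> V" "d \<in> V" "t = (f a, f b, f c, f d)"
        unfolding W by auto
      then have "(a, b, c, d) \<in> quads E"
        using t by (simp add: quads_def iff eq)
      then show "t \<in> ?g ` quads E"
        using abcd by force
    qed
  qed
qed

text \<open>The common induction step for paths and lassos: the leaf receives the new label
  \<open>m\<close>, which fits only if its neighbour carries the last old label. For this reason
  \<open>path_iso\<close>, \<open>cycle_iso\<close> and \<open>lasso_iso\<close> all prescribe which
  vertex gets the last label.\<close>

lemma (in conn_graph_leaf) extend_iso:
  assumes g: "rel_iso g (V - {v}) E' {0..<m} R" "g u = m - 1" and R: "R \<subseteq> {0..<m} \<times> {0..<m}" and "m > 0"
  shows "rel_iso (g(v := m)) V E {0..<Suc m} (R \<union> {(m - 1, m), (m, m - 1)})"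
  unfolding rel_iso_def
proof (intro conjI ballI)
  have bij: "bij_betw g (V - {v}) {0..<m}"
    and iff: "\<And>x y. x \<in> V - {v} \<Longrightarrow> y \<in> V - {v} \<Longrightarrow> (g x, g y) \<in> R \<longleftrightarrow> (x, y) \<in> E'"
    using g(1) by (auto simp: rel_iso_def)
  have "bij_betw (g(v := m)) (V - {v}) {0..<m}"
    using bij by (rule bij_betw_cong[THEN iffD1, rotated]) simp
  then have "bij_betw (g(v := m)) (V - {v} \<union> {v}) ({0..<m} \<union> {(g(v := m)) v})"
    by (subst notIn_Un_bij_betw3[symmetric]) auto
  moreover have "V - {v} \<union> {v} = V" "{0..<m} \<union> {(g(v := m)) v} = {0..<Suc m}"
    using v_in by auto
  ultimately show "bij_betw (g(v := m)) V {0..<Suc m}"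
    by simp
  have less: "g x < m" if "x \<in> V" "x \<noteq> v" for x
    using bij_betwE[OF bij] that by auto
  have gu: "g x = m - 1 \<longleftrightarrow> x = u" if "x \<in> V" "x \<noteq> v" for x
    using bij_betw_imp_inj_on[OF bij] that g(2) uv by (metis DiffI inj_on_eq_iff singletonD)
  have R_less: "(a, b) \<in> R \<Longrightarrow> a < m \<and> b < m" for a b
    using R by auto
  fix x y assume xy: "x \<in> V" "y \<in> V"
  consider "x = v" "y = v" | "x = v" "y \<noteq> v" | "x \<noteq> v" "y = v" | "x \<noteq> v" "y \<noteq> v"
    by blast
  then show "((g(v := m)) x, (g(v := m)) y) \<in> R \<union> {(m - 1, m), (m, m - 1)} \<longleftrightarrow> (x, y) \<in> E"
  proof cases
    case 1
    then show ?thesis using no_loop R_less[of m m] \<open>m > 0\<close> by auto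
  next
    case 2
    then show ?thesis using R_less[of m "g y"] gu[of y] xy \<open>m > 0\<close> by (auto simp: leaf_iff)
  next
    case 3
    then show ?thesis using R_less[of "g x" m] gu[of x] xy \<open>m > 0\<close> by (auto simp: leaf_iff)
  next
    case 4
    then show ?thesis using less[of x] less[of y] xy iff[of x y] by (auto simp: E'_iff)
  qed
qed

text \<open>Peeling off the end \<open>v\<close> lowers the degree of its neighbour \<open>u\<close>
  to at most 1, so \<open>u\<close> can serve as the end of the smaller path.\<close>

lemma (in conn_graph) path_iso:
  assumes "v \<in> V" "deg E v \<le> 1" "\<And>x. x \<in> V \<Longrightarrow> deg E x \<le> 2"
  shows "\<exists>f. rel_iso f V E {0..<card V} (path_rel (card V)) \<and> f v = card V - 1"
  using assms conn_graph_axioms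
proof (induction "card V" arbitrary: V E v)
  case 0
  then interpret conn_graph V E by blast
  show ?case using 0 finite_V nonempty by simp
next
  case (Suc m)
  then interpret conn_graph V E by blast
  show ?case
  proof (cases "m = 0")
    case True
    then have V: "V = {v}"
      using Suc.hyps(2) Suc.prems(1) by (metis One_nat_def card_1_singletonE singletonD)
    then show ?thesis
      using no_loop by (intro exI[of _ "\<lambda>_. 0"]) (auto simp: rel_iso_def path_rel_def bij_betw_def)
  next
    case False
    then have "deg E v = 1"
      using deg_ge_1[of v] Suc.hyps(2) Suc.prems(1,2) by simp
    then obtain u where "conn_graph_leaf V E v u"
      using leaf_if_deg_1 Suc.prems(1) by blast
    then interpret conn_graph_leaf V E v u .
    have m: "m = card (V - {v})"
      using Suc.hyps(2) card_V_peel by simp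
    have "deg E' u \<le> 1"
      using deg_peel_nbr Suc.prems(3)[of u] uv by simp
    moreover have "deg E' x \<le> 2" if "x \<in> V - {v}" for x
      using that deg_peel_other[of x] Suc.prems(3)[of x] \<open>deg E' u \<le> 1\<close> by (cases "x = u") auto
    ultimately obtain g where g: "rel_iso g (V - {v}) E' {0..<m} (path_rel m)" "g u = m - 1"
      using Suc.hyps(1)[OF m _ _ _ peel.conn_graph_axioms, of u] uv unfolding m[symmetric] by auto
    have "path_rel m \<subseteq> {0..<m} \<times> {0..<m}"
      by (auto simp: path_rel_def)
    then have "rel_iso (g(v := m)) V E {0..<Suc m} (path_rel (Suc m))"
      using extend_iso[OF g] False by (simp add: path_rel_Suc)
    then show ?thesis
      using Suc.hyps(2) by (intro exI[of _ "g(v := m)"]) simp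
  qed
qed

text \<open>An edge \<open>uv\<close> of a 2-regular graph is no bridge, so deleting it leaves a
  connected graph in which only \<open>u\<close> and \<open>v\<close> have degree 1. This is a path
  with \<open>v\<close> last and \<open>u\<close> first, and the deleted edge closes it.\<close>

lemma (in conn_graph) cycle_iso:
  assumes reg: "\<And>x. x \<in> V \<Longrightarrow> deg E x = 2" and "v \<in> V"
  shows "3 \<le> card V"
    and "\<exists>f. rel_iso f V E {0..<card V} (lasso (card V) (card V)) \<and> f v = card V - 1"
proof -
  let ?n = "card V"
  have "E `` {v} \<subseteq> V - {v}"
    using in_V no_loop by auto
  then have "2 \<le> card (V - {v})"
    using card_mono[of "V - {v}" "E `` {v}"] finite_V reg[OF \<open>v \<in> V\<close>] by (simp add: deg_def)
  then show n3: "3 \<le> ?n"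
    using \<open>v \<in> V\<close> finite_V by simp
  have "E `` {v} \<noteq> {}"
    using reg[OF \<open>v \<in> V\<close>] by (auto simp: deg_def)
  then obtain u where "u \<in> E `` {v}"
    by blast
  then have vu: "(v, u) \<in> E" "(u, v) \<in> E" "u \<noteq> v" "u \<in> V"
    using symE no_loop in_V by auto
  define F where "F = remove_edge E u v"
  have E_F: "(x, y) \<in> E \<longleftrightarrow> (x, y) \<in> F \<or> x = u \<and> y = v \<or> x = v \<and> y = u" for x y
    using vu by (auto simp: F_def remove_edge_def)
  have symF: "sym F"
    unfolding F_def using sym_E by (rule sym_remove_edge)
  have "(u, v) \<in> F\<^sup>*"
    using two_regular_no_bridges[OF reg] vu by (auto simp: F_def bridges_def)
  then have "E \<subseteq> F\<^sup>*"
    using rtrancl_sym[OF symF] by (auto simp: E_F)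
  then have EF: "E\<^sup>* \<subseteq> F\<^sup>*"
    by (metis rtrancl_idemp rtrancl_mono)
  interpret F: conn_graph V F
  proof
    show "finite V" "V \<noteq> {}" by (fact finite_V nonempty)+
    show "F \<subseteq> V \<times> V" "irrefl F"
      using E_subset no_loop by (auto simp: F_def remove_edge_def irrefl_def)
    show "sym F" by (fact symF)
    show "(x, y) \<in> F\<^sup>*" if "x \<in> V" "y \<in> V" for x y
      using connected[OF that] EF by blast
  qed
  have deg_F: "deg F x = (if x = u \<or> x = v then 1 else 2)" if "x \<in> V" for x
  proof -
    have "F `` {x} = E `` {x} - (if x = u then {v} else if x = v then {u} else {})"
      using vu by (auto simp: F_def remove_edge_def)
    then show ?thesis
      using reg[OF that] vu finite_nbrs by (auto simp: deg_def)
  qed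
  obtain f where f: "rel_iso f V F {0..<?n} (path_rel ?n)" "f v = ?n - 1"
    using F.path_iso[OF \<open>v \<in> V\<close>] deg_F \<open>v \<in> V\<close> by force
  have bij: "bij_betw f V {0..<?n}"
    and iff: "\<And>x y. x \<in> V \<Longrightarrow> y \<in> V \<Longrightarrow> (f x, f y) \<in> path_rel ?n \<longleftrightarrow> (x, y) \<in> F"
    using f(1) by (auto simp: rel_iso_def)
  have eq: "f x = f y \<longleftrightarrow> x = y" if "x \<in> V" "y \<in> V" for x y
    using bij that by (metis bij_betw_imp_inj_on inj_on_eq_iff)
  have fu_less: "f u < ?n"
    using bij_betwE[OF bij] vu by auto
  \<comment> \<open>Any other label of \<open>u\<close> is interior to the path, and the vertices
    labelled just before and after it would be two neighbours of \<open>u\<close> in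
    \<open>F\<close>.\<close>
  have "f u = 0"
  proof (rule ccontr)
    assume "f u \<noteq> 0"
    have "f u \<noteq> ?n - 1"
      using f(2) eq[of u v] vu \<open>v \<in> V\<close> by simp
    then have "Suc (f u) \<in> f ` V" "f u - 1 \<in> f ` V"
      using bij_betw_imp_surj_on[OF bij] fu_less by auto
    then obtain a b where ab: "a \<in> V" "f a = Suc (f u)" "b \<in> V" "f b = f u - 1"
      by (metis imageE)
    then have "(u, a) \<in> F" "(u, b) \<in> F"
      using iff[of u a] iff[of u b] vu fu_less \<open>f u \<noteq> ?n - 1\<close> \<open>f u \<noteq> 0\<close> by (auto simp: path_rel_def)
    moreover have "a \<noteq> b" using ab by auto
    ultimately have "card {a, b} \<le> deg F u"
      unfolding deg_def using F.finite_nbrs by (intro card_mono) auto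
    then show False
      using deg_F vu \<open>a \<noteq> b\<close> by simp
  qed
  have "rel_iso f V E {0..<?n} (lasso ?n ?n)"
    unfolding rel_iso_def
  proof (intro conjI ballI bij)
    fix x y assume xy: "x \<in> V" "y \<in> V"
    have "(f x, f y) = (?n - 1, 0) \<longleftrightarrow> x = v \<and> y = u" "(f x, f y) = (0, ?n - 1) \<longleftrightarrow> x = u \<and> y = v"
      using eq[of x v] eq[of y u] eq[of x u] eq[of y v] xy vu \<open>v \<in> V\<close> \<open>f u = 0\<close> f(2) by auto
    then show "(f x, f y) \<in> lasso ?n ?n \<longleftrightarrow> (x, y) \<in> E"
      using iff[OF xy] unfolding lasso_def E_F Un_iff insert_iff empty_iff by auto
  qed
  then show "\<exists>f. rel_iso f V E {0..<?n} (lasso ?n ?n) \<and> f v = ?n - 1"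
    using f(2) by blast
qed

section \<open>Connected graphs with as many edges as vertices\<close>

lemma (in conn_graph) two_le_card_V:
  assumes "card E = 2 * card V"
  shows "2 \<le> card V"
proof (rule ccontr)
  assume "\<not> ?thesis"
  then have "card V = 1"
    using finite_V nonempty card_gt_0_iff[of V] by simp
  then obtain x where "V = {x}"
    by (metis card_1_singletonE)
  then have "E = {}"
    using E_subset no_loop by auto
  then show False
    using assms \<open>card V = 1\<close> by simp
qed

text \<open>The average degree is exactly 2. The other vertices contribute no deficit, so the degree
  of \<open>v\<close> plus the total excess of the others over 2 equals 2.\<close>

lemma (in conn_graph) deg_le_2_all_2:
  assumes "card E = 2 * card V" "v \<in> V" "\<And>x. x \<in> V - {v} \<Longrightarrow> 2 \<le> deg E x"
  shows "deg E v \<le> 2" and "deg E v = 2 \<Longrightarrow> x \<in> V \<Longrightarrow> deg E x = 2"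
proof -
  have V: "card V = Suc (card (V - {v}))"
    using finite_V assms(2) by (metis card_Suc_Diff1)
  have "deg E v + (\<Sum>x\<in>V - {v}. deg E x) = 2 * card V"
    using sum_deg sum.remove[OF finite_V assms(2), of "deg E"] assms(1) by simp
  \<comment> \<open>Natural subtraction is exact here because these degrees are at least 2.\<close>
  moreover have "(\<Sum>x\<in>V - {v}. deg E x) = (\<Sum>x\<in>V - {v}. deg E x - 2) + 2 * card (V - {v})"
  proof -
    have "(\<Sum>x\<in>V - {v}. deg E x) = (\<Sum>x\<in>V - {v}. (deg E x - 2) + 2)"
    proof (intro sum.cong)
      show "deg E x = deg E x - 2 + 2" if "x \<in> V - {v}" for x
        using assms(3)[OF that] by linarith
    qed simp
    then show ?thesis
      unfolding sum.distrib by simp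
  qed
  ultimately have *: "deg E v + (\<Sum>x\<in>V - {v}. deg E x - 2) = 2"
    using V by simp
  then show "deg E v \<le> 2" by simp
  assume v: "deg E v = 2" and x: "x \<in> V"
  then have "(\<Sum>x\<in>V - {v}. deg E x - 2) = 0"
    using * by simp
  then show "deg E x = 2"
    using v assms(3)[of x] x finite_V by (cases "x = v") (auto intro: le_antisym)
qed

text \<open>The invariant is that only \<open>v\<close> may be a leaf. If \<open>v\<close> has
  degree 2, the graph is 2-regular and hence a cycle. Otherwise \<open>v\<close> is peeled off and
  its neighbour \<open>u\<close> takes over the role of \<open>v\<close>. The bound on the number of
  bridges keeps the cycle length at least 3.\<close>

lemma (in conn_graph) lasso_iso:
  assumes "card E = 2 * card V" "v \<in> V" "\<And>x. x \<in> V - {v} \<Longrightarrow> 2 \<le> deg E x"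
  shows "card (bridges E) + 3 \<le> card V \<and>
    (\<exists>f. rel_iso f V E {0..<card V} (lasso (card V) (card V - card (bridges E))) \<and> f v = card V - 1)"
  using assms conn_graph_axioms
proof (induction "card V" arbitrary: V E v)
  case 0
  then interpret conn_graph V E by blast
  show ?case using 0 finite_V nonempty by simp
next
  case (Suc m)
  then interpret conn_graph V E by blast
  have n2: "2 \<le> card V"
    using two_le_card_V Suc.prems(1) .
  have "deg E v \<le> 2"
    using deg_le_2_all_2(1) Suc.prems(1-3) by blast
  moreover have "1 \<le> deg E v"
    using deg_ge_1 n2 Suc.prems(2) by blast
  ultimately consider "deg E v = 2" | "deg E v = 1" by linarith
  then show ?case
  proof cases
    case 1
    then have reg: "deg E x = 2" if "x \<in> V" for x
      using deg_le_2_all_2(2) Suc.prems(1-3) that by blast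
    show ?thesis
      using cycle_iso[OF reg Suc.prems(2)] two_regular_no_bridges[OF reg] by simp
  next
    case 2
    then obtain u where "conn_graph_leaf V E v u"
      using leaf_if_deg_1 Suc.prems(2) by blast
    then interpret conn_graph_leaf V E v u .
    have m: "m = card (V - {v})"
      using Suc.hyps(2) card_V_peel by simp
    have "card (bridges E') + 3 \<le> m \<and>
      (\<exists>g. rel_iso g (V - {v}) E' {0..<m} (lasso m (m - card (bridges E'))) \<and> g u = m - 1)"
      unfolding m
    proof (rule Suc.hyps(1)[OF m _ _ _ peel.conn_graph_axioms])
      show "card E' = 2 * card (V - {v})"
        using card_E_peel card_V_peel Suc.prems(1) by simp
      show "u \<in> V - {v}" using uv by simp
      show "2 \<le> deg E' x" if "x \<in> V - {v} - {u}" for x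
        using that Suc.prems(3)[of x] deg_peel_other[of x] by simp
    qed
    then obtain g where b: "card (bridges E') + 3 \<le> m"
      and g: "rel_iso g (V - {v}) E' {0..<m} (lasso m (m - card (bridges E')))" "g u = m - 1"
      by blast
    \<comment> \<open>The cycle length is unchanged: peeling lowers the number of vertices and the
      number of bridges by one each.\<close>
    have "rel_iso (g(v := m)) V E {0..<Suc m} (lasso (Suc m) (m - card (bridges E')))"
      using extend_iso[OF g lasso_subset] b lasso_Suc[of m] by simp
    then show ?thesis
      using b card_bridges_peel unfolding Suc.hyps(2)[symmetric] by (intro conjI exI[of _ "g(v := m)"]) auto
  qed
qed

text \<open>Peeling off a leaf preserves both counts and the difference between vertices and
  bridges. Once no leaf is left the graph is 2-regular, hence a cycle of exactly that
  length.\<close>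

lemma (in conn_graph) unicyclic_core:
  assumes "card E = 2 * card V"
  shows "card (triangles E) = card (triangles (lasso (card V - card (bridges E)) (card V - card (bridges E)))) \<and>
    card (quads E) = card (quads (lasso (card V - card (bridges E)) (card V - card (bridges E))))"
  using assms conn_graph_axioms
proof (induction "card V" arbitrary: V E)
  case 0
  then interpret conn_graph V E by blast
  show ?case using 0 finite_V nonempty by simp
next
  case (Suc m)
  then interpret conn_graph V E by blast
  have n2: "2 \<le> card V"
    using two_le_card_V Suc.prems(1) .
  show ?case
  proof (cases "\<exists>v\<in>V. deg E v = 1")
    case True
    then obtain v u where "conn_graph_leaf V E v u"
      using leaf_if_deg_1 by blast
    then interpret conn_graph_leaf V E v u .
    have m: "m = card (V - {v})"
      using Suc.hyps(2) card_V_peel by simp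
    have "card E' = 2 * card (V - {v})"
      using card_E_peel card_V_peel Suc.prems(1) by simp
    from Suc.hyps(1)[OF m this peel.conn_graph_axioms] show ?thesis
      by (simp add: triangles_peel quads_peel card_V_peel card_bridges_peel)
  next
    case False
    obtain v where "v \<in> V" using nonempty by blast
    have deg2: "2 \<le> deg E x" if "x \<in> V" for x
      using deg_ge_1[OF that n2] False that by (cases "deg E x = 1") auto
    then have "deg E v = 2"
      using deg_le_2_all_2(1)[OF Suc.prems(1) \<open>v \<in> V\<close>] \<open>v \<in> V\<close> by fastforce
    then have reg: "deg E x = 2" if "x \<in> V" for x
      using deg_le_2_all_2(2)[OF Suc.prems(1) \<open>v \<in> V\<close>] deg2 that by blast
    obtain f where "rel_iso f V E {0..<card V} (lasso (card V) (card V))"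
      using cycle_iso(2)[OF reg \<open>v \<in> V\<close>] by blast
    then show ?thesis
      using card_triangles_iso card_quads_iso E_subset lasso_subset[of "card V" "card V"] n2
        two_regular_no_bridges[OF reg] by fastforce
  qed
qed

section \<open>Connectedness, degrees and bridges of the lasso\<close>

lemma conn_graph_lasso:
  assumes "3 \<le> m" "m \<le> n"
  shows "conn_graph {0..<n} (lasso n m)"
proof
  show "finite {0..<n}" "{0..<n} \<noteq> {}" "lasso n m \<subseteq> {0..<n} \<times> {0..<n}"
    using assms by (auto simp: lasso_subset)
  show sym: "sym (lasso n m)"
    by (auto simp: sym_def lasso_def path_rel_def)
  show "irrefl (lasso n m)"
    using assms by (auto simp: irrefl_def lasso_def path_rel_def)
  have reach: "(0, x) \<in> (lasso n m)\<^sup>*" if "x < n" for x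
    using that
  proof (induction x)
    case (Suc x)
    then have "(x, Suc x) \<in> lasso n m"
      by (auto simp: lasso_def path_rel_def)
    with Suc show ?case
      by (auto intro: rtrancl_into_rtrancl)
  qed simp
  show "(x, y) \<in> (lasso n m)\<^sup>*" if "x \<in> {0..<n}" "y \<in> {0..<n}" for x y
    using reach[of x] reach[of y] that rtrancl_sym[OF sym, of 0 x] by (auto intro: rtrancl_trans)
qed

text \<open>Apart from the last vertex, every vertex has a successor and a predecessor on the
  spanning path, where \<open>m - 1\<close> stands in as the predecessor of 0.\<close>

lemma deg_lasso_ge_2:
  assumes "3 \<le> m" "m \<le> n" "x < n - 1"
  shows "2 \<le> deg (lasso n m) x"
proof -
  interpret conn_graph "{0..<n}" "lasso n m"
    using assms by (intro conn_graph_lasso)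
  let ?p = "if x = 0 then m - 1 else x - 1"
  have "{Suc x, ?p} \<subseteq> lasso n m `` {x}"
    using assms by (auto simp: lasso_def path_rel_def)
  then have "card {Suc x, ?p} \<le> deg (lasso n m) x"
    unfolding deg_def by (intro card_mono finite_nbrs)
  moreover have "Suc x \<noteq> ?p"
    using assms by auto
  ultimately show ?thesis
    by simp
qed

text \<open>Induction on the length of the tail, starting from the cycle: vertex \<open>n\<close> is
  a leaf of the longer lasso, so the effect of peeling is read backwards.\<close>

lemma card_lasso:
  assumes "3 \<le> m" "m \<le> n"
  shows "card (lasso n m) = 2 * n \<and> card (bridges (lasso n m)) = n - m"
  using assms(2)
proof (induction n rule: dec_induct)
  case base
  interpret conn_graph "{0..<m}" "lasso m m"
    using assms by (intro conn_graph_lasso) auto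
  have reg: "deg (lasso m m) x = 2" if "x \<in> {0..<m}" for x
  proof -
    let ?s = "if Suc x = m then 0 else Suc x" and ?p = "if x = 0 then m - 1 else x - 1"
    have "lasso m m `` {x} = {?s, ?p}"
      using assms that by (auto simp: lasso_def path_rel_def)
    moreover have "?s \<noteq> ?p"
      using assms that by auto
    ultimately show ?thesis
      by (simp add: deg_def)
  qed
  then show ?case
    using sum_deg two_regular_no_bridges[OF reg] by simp
next
  case (step n)
  have "n > 0" using assms step by simp
  interpret L: conn_graph "{0..<Suc n}" "lasso (Suc n) m"
    using assms step by (intro conn_graph_lasso) auto
  interpret conn_graph_leaf "{0..<Suc n}" "lasso (Suc n) m" n "n - 1"
    using assms step by unfold_locales (auto simp: lasso_def path_rel_def)
  have "remove_edge (lasso (Suc n) m) (n - 1) n = lasso n m"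
    using \<open>n > 0\<close> lasso_subset[of m n] assms step by (auto simp: lasso_Suc remove_edge_def)
  then show ?case
    using step card_E_peel card_bridges_peel by simp
qed

section \<open>Degree sequences\<close>

lemma self_le_power2_int: "(x :: int) \<le> x\<^sup>2"
  by (cases "x \<le> 0") (auto simp: self_le_power intro: order_trans[OF _ zero_le_power2])

text \<open>Squares are centred at the average degree 2, where the linear term vanishes. The
  integers are used because a leaf deviates by -1.\<close>

lemma sum_power2_shift:
  fixes d :: "'a \<Rightarrow> nat"
  assumes "finite V" "(\<Sum>x\<in>V. d x) = 2 * card V"
  shows "int (\<Sum>x\<in>V. (d x)\<^sup>2) = (\<Sum>x\<in>V. (int (d x) - 2)\<^sup>2) + 4 * int (card V)"
    and "(\<Sum>x\<in>V. int (d x) - 2) = 0"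
proof -
  have "(\<Sum>x\<in>V. int (d x)) = 2 * int (card V)"
    using assms(2) by (metis of_nat_mult of_nat_numeral of_nat_sum)
  then show "int (\<Sum>x\<in>V. (d x)\<^sup>2) = (\<Sum>x\<in>V. (int (d x) - 2)\<^sup>2) + 4 * int (card V)"
    "(\<Sum>x\<in>V. int (d x) - 2) = 0"
    by (simp_all add: power2_diff sum.distrib sum_subtractf flip: sum_distrib_left sum_distrib_right)
qed

text \<open>The deviation at \<open>v\<close> is 0 or -1. The other deviations are nonnegative and
  sum to at most 1, so each is 0 or 1 and equals its own square. The squared deviations therefore
  sum to at most 2.\<close>

lemma (in conn_graph) sum_deg2_upper:
  assumes E: "card E = 2 * card V" and v: "v \<in> V" and deg: "\<And>x. x \<in> V - {v} \<Longrightarrow> 2 \<le> deg E x"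
  shows "(\<Sum>x\<in>V. (deg E x)\<^sup>2) \<le> 4 * card V + 2"
proof -
  define f where "f x = int (deg E x) - 2" for x
  note shift = sum_power2_shift[OF finite_V, of "deg E", folded f_def, unfolded sum_deg, OF E]
  have "- 1 \<le> f v" "f v \<le> 0"
    using deg_ge_1[OF v two_le_card_V[OF E]] deg_le_2_all_2(1)[OF E v deg] by (auto simp: f_def)
  have sum_others: "(\<Sum>x\<in>V - {v}. f x) = - f v"
    using shift(2) sum.remove[OF finite_V v, of f] by simp
  have "(f x)\<^sup>2 = f x" if x: "x \<in> V - {v}" for x
  proof -
    have "0 \<le> f y" if "y \<in> V - {v}" for y
      using deg[OF that] by (simp add: f_def)
    then have "0 \<le> f x" "f x \<le> 1"
      using member_le_sum[of x "V - {v}" f] x finite_V sum_others \<open>- 1 \<le> f v\<close> by auto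
    then have "f x = 0 \<or> f x = 1" by linarith
    then show ?thesis by auto
  qed
  then have "(\<Sum>x\<in>V - {v}. (f x)\<^sup>2) = - f v"
    using sum_others by simp
  moreover have "f v = 0 \<or> f v = - 1"
    using \<open>- 1 \<le> f v\<close> \<open>f v \<le> 0\<close> by linarith
  ultimately have "(\<Sum>x\<in>V. (f x)\<^sup>2) \<le> 2"
    using sum.remove[OF finite_V v, of "\<lambda>x. (f x)\<^sup>2"] by auto
  then show ?thesis
    using shift(1) by linarith
qed

text \<open>The two leaves deviate by -1 each, so the remaining deviations sum to 2. As an integer
  is at most its square, the squared deviations sum to at least 1 + 1 + 2.\<close>

lemma (in conn_graph) sum_deg2_lower:
  assumes E: "card E = 2 * card V" and v: "v \<in> V" "deg E v = 1" and w: "w \<in> V" "deg E w = 1" "v \<noteq> w"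
  shows "4 * card V + 4 \<le> (\<Sum>x\<in>V. (deg E x)\<^sup>2)"
proof -
  define f where "f x = int (deg E x) - 2" for x
  note shift = sum_power2_shift[OF finite_V, of "deg E", folded f_def, unfolded sum_deg, OF E]
  have split: "sum g V = g v + (g w + sum g (V - {v} - {w}))" for g :: "'a \<Rightarrow> int"
    using sum.remove[of V v g] sum.remove[of "V - {v}" w g] finite_V v w by simp
  have "(\<Sum>x\<in>V - {v} - {w}. f x) = 2"
    using split[of f] shift(2) v w by (simp add: f_def)
  moreover have "(\<Sum>x\<in>V - {v} - {w}. f x) \<le> (\<Sum>x\<in>V - {v} - {w}. (f x)\<^sup>2)"
    by (intro sum_mono self_le_power2_int)
  ultimately have "4 \<le> (\<Sum>x\<in>V. (f x)\<^sup>2)"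
    using split[of "\<lambda>x. (f x)\<^sup>2"] v w by (simp add: f_def)
  then show ?thesis
    using shift(1) by linarith
qed

text \<open>The leaf \<open>w\<close> is still a leaf after \<open>v\<close> has been peeled off, so
  two peelings remove two bridges.\<close>

lemma (in conn_graph) two_leaves_two_bridges:
  assumes v: "v \<in> V" "deg E v = 1" and w: "w \<in> V" "deg E w = 1" "v \<noteq> w" and V: "3 \<le> card V"
  shows "2 \<le> card (bridges E)"
proof -
  obtain u where "conn_graph_leaf V E v u"
    using leaf_if_deg_1 v by blast
  then interpret conn_graph_leaf V E v u .
  have w': "w \<in> V - {v}" "2 \<le> card (V - {v})"
    using w V card_V_peel by auto
  \<comment> \<open>If the leaves were adjacent, \<open>w\<close> would be isolated in a connected
    graph with at least two vertices.\<close>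
  have "w \<noteq> u"
    using deg_peel_nbr peel.deg_ge_1[OF w'] w(2) by auto
  then have "deg E' w = 1"
    using deg_peel_other w by metis
  then obtain u' where "conn_graph_leaf (V - {v}) E' w u'"
    using peel.leaf_if_deg_1 w' by blast
  then interpret l: conn_graph_leaf "V - {v}" E' w u' .
  show ?thesis
    using card_bridges_peel l.card_bridges_peel by simp
qed

section \<open>Spectral moments count closed walks\<close>

definition closed_walks4 :: "'a rel \<Rightarrow> ('a \<times> 'a \<times> 'a \<times> 'a) set" where
  "closed_walks4 E = {(a, b, c, d). (a, b) \<in> E \<and> (b, c) \<in> E \<and> (c, d) \<in> E \<and> (d, a) \<in> E}"

text \<open>A closed walk of length 4 either runs around a 4-cycle or has two equal opposite
  vertices. Each of the two coincidences \<open>A\<close> and \<open>B\<close> amounts to a vertex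
  with an ordered pair of neighbours; both hold exactly when one edge is traversed back and forth.
  Moving \<open>card E\<close> to the left avoids natural subtraction.\<close>

lemma (in conn_graph) card_closed_walks4:
  "card (closed_walks4 E) + card E = card (quads E) + 2 * (\<Sum>x\<in>V. (deg E x)\<^sup>2)"
proof -
  define N where "N = (SIGMA x:V. E `` {x} \<times> E `` {x})"
  have card_N: "card N = (\<Sum>x\<in>V. (deg E x)\<^sup>2)"
    using finite_V finite_nbrs by (simp add: N_def deg_def card_cartesian_product power2_eq_square)
  define A where "A = {(a, b, c, d) \<in> closed_walks4 E. a = c}"
  define B where "B = {(a, b, c, d) \<in> closed_walks4 E. b = d}"
  have "closed_walks4 E \<subseteq> V \<times> V \<times> V \<times> V"
    using in_V by (auto simp: closed_walks4_def)
  then have fin: "finite (closed_walks4 E)"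
    by (rule finite_subset) (intro finite_cartesian_product finite_V)
  have sub: "A \<subseteq> closed_walks4 E" "B \<subseteq> closed_walks4 E" "quads E \<subseteq> closed_walks4 E"
    by (auto simp: A_def B_def quads_def closed_walks4_def)
  note fins = fin sub[THEN finite_subset, OF fin]
  have E_V: "x \<in> V" if "(x, y) \<in> E" for x y
    using in_V that by blast
  have A_iff: "(a, b, c, d) \<in> A \<longleftrightarrow> c = a \<and> (a, b) \<in> E \<and> (a, d) \<in> E" for a b c d
    unfolding A_def closed_walks4_def mem_Collect_eq prod.case using symE by metis
  have B_iff: "(a, b, c, d) \<in> B \<longleftrightarrow> d = b \<and> (b, a) \<in> E \<and> (b, c) \<in> E" for a b c d
    unfolding B_def closed_walks4_def mem_Collect_eq prod.case using symE by metis
  have "bij_betw (\<lambda>(a, b, d). (a, b, a, d)) N A"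
    by (rule bij_betw_byWitness[where f' = "\<lambda>(a, b, c, d). (a, b, d)"])
      (auto simp: N_def A_iff intro: E_V)
  then have "card A = card N"
    by (rule bij_betw_same_card[symmetric])
  moreover have "bij_betw (\<lambda>(b, a, c). (a, b, c, b)) N B"
    by (rule bij_betw_byWitness[where f' = "\<lambda>(a, b, c, d). (b, a, c)"])
      (auto simp: N_def B_iff intro: E_V)
  then have "card B = card N"
    by (rule bij_betw_same_card[symmetric])
  moreover have "bij_betw (\<lambda>(a, b). (a, b, a, b)) E (A \<inter> B)"
    by (rule bij_betw_byWitness[where f' = "\<lambda>(a, b, c, d). (a, b)"])
      (auto simp: A_iff B_iff symE)
  then have "card (A \<inter> B) = card E"
    by (rule bij_betw_same_card[symmetric])
  moreover have "card A + card B = card (A \<union> B) + card (A \<inter> B)"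
    using fins by (intro card_Un_Int)
  moreover have "closed_walks4 E = quads E \<union> (A \<union> B)" "quads E \<inter> (A \<union> B) = {}"
    by (auto simp: A_def B_def quads_def closed_walks4_def)
  then have "card (closed_walks4 E) = card (quads E) + card (A \<union> B)"
    using fins by (simp add: card_Un_disjoint)
  ultimately show ?thesis
    using card_N by simp
qed

definition adj :: "'a rel \<Rightarrow> 'a \<Rightarrow> 'a \<Rightarrow> real" where
  "adj E x y = of_bool ((x, y) \<in> E)"

text \<open>The entry of the \<open>k\<close>-th power of the adjacency matrix, indexed by vertices
  instead of positions and so free of any enumeration of \<open>V\<close>.\<close>

primrec num_walks :: "'a set \<Rightarrow> 'a rel \<Rightarrow> nat \<Rightarrow> 'a \<Rightarrow> 'a \<Rightarrow> real" where
  "num_walks V E 0 x y = of_bool (x = y)"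
| "num_walks V E (Suc k) x y = (\<Sum>z\<in>V. num_walks V E k x z * adj E z y)"

lemma spectral_moment_eq_closed_walks:
  fixes G :: "'a pair_pre_digraph"
  assumes fin: "finite (pverts G)" and sym: "sym (parcs G)"
  shows "spectral_moment k G = (\<Sum>x\<in>pverts G. num_walks (pverts G) (parcs G) k x x)"
proof -
  obtain vs where vs: "distinct vs" "set vs = pverts G"
    using finite_distinct_list[OF fin] by blast
  let ?n = "length vs" and ?A = "adj_matrix G vs"
  have A: "?A \<in> carrier_mat ?n ?n"
    by (simp add: adj_matrix_def)
  have reindex: "(\<Sum>i<?n. g (vs ! i)) = (\<Sum>x\<in>pverts G. g x)" for g :: "'a \<Rightarrow> real"
    using sum.reindex_bij_betw[OF bij_betw_nth[OF vs(1) refl vs(2)[symmetric]], of g]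
    by (simp add: lessThan_atLeast0)
  have entries: "(?A ^\<^sub>m k) $$ (i, j) = num_walks (pverts G) (parcs G) k (vs ! i) (vs ! j)"
    if "i < ?n" "j < ?n" for i j k
    using that
  proof (induction k arbitrary: j)
    case 0
    then show ?case
      using A vs(1) by (auto simp: nth_eq_iff_index_eq)
  next
    case (Suc k)
    have "(?A ^\<^sub>m Suc k) $$ (i, j) = (\<Sum>l<?n. (?A ^\<^sub>m k) $$ (i, l) * ?A $$ (l, j))"
      using Suc.prems A by (simp add: scalar_prod_def lessThan_atLeast0)
    also have "\<dots> = (\<Sum>l<?n. num_walks (pverts G) (parcs G) k (vs ! i) (vs ! l) * adj (parcs G) (vs ! l) (vs ! j))"
      using Suc by (intro sum.cong) (auto simp: adj_matrix_def adj_def)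
    finally show ?case
      by (simp add: reindex[of "\<lambda>z. num_walks (pverts G) (parcs G) k (vs ! i) z * adj (parcs G) z (vs ! j)"])
  qed
  have "?A $$ (i, j) = ?A $$ (j, i)" if "i < ?n" "j < ?n" for i j
    using that sym by (auto simp: adj_matrix_def dest: symD)
  then have "spectral_moment k G = mat_trace (?A ^\<^sub>m k)"
    unfolding spectral_moment_def adj_spectrum_eq[OF vs] by (rule sum_proots_real_symmetric[OF A])
  also have "\<dots> = (\<Sum>i<?n. num_walks (pverts G) (parcs G) k (vs ! i) (vs ! i))"
    using A entries by (simp add: mat_trace_def)
  also have "\<dots> = (\<Sum>x\<in>pverts G. num_walks (pverts G) (parcs G) k x x)"
    by (rule reindex)
  finally show ?thesis .
qed

lemma num_walks_1:
  assumes "finite V" "x \<in> V"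
  shows "num_walks V E (Suc 0) x y = adj E x y"
  using assms by (simp add: of_bool_def if_distrib[of "\<lambda>t. t * _"] cong: if_cong)

context conn_graph
begin

lemma moment_0: "(\<Sum>x\<in>V. num_walks V E 0 x x) = card V"
  by simp

lemma moment_1: "(\<Sum>x\<in>V. num_walks V E 1 x x) = 0"
  using num_walks_1[OF finite_V] no_loop by (simp add: adj_def del: num_walks.simps)

lemma moment_2: "(\<Sum>x\<in>V. num_walks V E 2 x x) = card E"
proof -
  have "(\<Sum>x\<in>V. num_walks V E 2 x x) = (\<Sum>x\<in>V. \<Sum>y\<in>V. of_bool ((x, y) \<in> E))"
    unfolding numeral_2_eq_2 num_walks.simps(2)[of V E "Suc 0"]
    using finite_V symE by (intro sum.cong) (auto simp: num_walks_1 adj_def simp del: num_walks.simps)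
  also have "\<dots> = (\<Sum>p\<in>V \<times> V. of_bool (p \<in> E))"
    by (simp add: sum.cartesian_product)
  also have "\<dots> = card (V \<times> V \<inter> E)"
    using finite_V by (simp add: sum_of_bool_eq Collect_mem_eq Int_def)
  also have "V \<times> V \<inter> E = E"
    using E_subset by blast
  finally show ?thesis .
qed

lemma moment_3: "(\<Sum>x\<in>V. num_walks V E 3 x x) = card (triangles E)"
proof -
  have "num_walks V E 3 x x = (\<Sum>z\<in>V. \<Sum>y\<in>V. of_bool ((x, y, z) \<in> triangles E))" if "x \<in> V" for x
    unfolding numeral_3_eq_3 num_walks.simps(2)[of V E "Suc (Suc 0)"] num_walks.simps(2)[of V E "Suc 0"]
      num_walks_1[OF finite_V that] sum_distrib_right
    by (intro sum.cong refl) (auto simp: adj_def triangles_def)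
  then have "(\<Sum>x\<in>V. num_walks V E 3 x x) = (\<Sum>x\<in>V. \<Sum>z\<in>V. \<Sum>y\<in>V. of_bool ((x, y, z) \<in> triangles E))"
    by (intro sum.cong refl)
  also have "\<dots> = (\<Sum>x\<in>V. \<Sum>y\<in>V. \<Sum>z\<in>V. of_bool ((x, y, z) \<in> triangles E))"
    by (intro sum.cong refl sum.swap)
  also have "\<dots> = (\<Sum>p\<in>V \<times> V \<times> V. of_bool (p \<in> triangles E))"
    by (simp add: sum.cartesian_product)
  also have "\<dots> = card (V \<times> V \<times> V \<inter> triangles E)"
    using finite_V by (simp add: sum_of_bool_eq Int_def)
  also have "V \<times> V \<times> V \<inter> triangles E = triangles E"
    using in_V by (auto simp: triangles_def)
  finally show ?thesis .
qed

lemma moment_4: "(\<Sum>x\<in>V. num_walks V E 4 x x) = card (closed_walks4 E)"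
proof -
  have four: "4 = Suc (Suc (Suc (Suc 0)))"
    by simp
  have "num_walks V E 4 a a = (\<Sum>d\<in>V. \<Sum>c\<in>V. \<Sum>b\<in>V. of_bool ((a, b, c, d) \<in> closed_walks4 E))"
    if "a \<in> V" for a
    unfolding four num_walks.simps(2)[of V E "Suc (Suc (Suc 0))"]
      num_walks.simps(2)[of V E "Suc (Suc 0)"] num_walks.simps(2)[of V E "Suc 0"]
      num_walks_1[OF finite_V that] sum_distrib_right
    by (intro sum.cong refl) (auto simp: adj_def closed_walks4_def)
  then have "(\<Sum>x\<in>V. num_walks V E 4 x x) =
      (\<Sum>a\<in>V. \<Sum>d\<in>V. \<Sum>c\<in>V. \<Sum>b\<in>V. of_bool ((a, b, c, d) \<in> closed_walks4 E))"
    by (intro sum.cong refl)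
  \<comment> \<open>Unfolding the recursion produces the inner vertices last to first; three
    exchanges of adjacent sums restore the order of the tuple.\<close>
  also have "\<dots> = (\<Sum>a\<in>V. \<Sum>c\<in>V. \<Sum>d\<in>V. \<Sum>b\<in>V. of_bool ((a, b, c, d) \<in> closed_walks4 E))"
    by (intro sum.cong refl sum.swap)
  also have "\<dots> = (\<Sum>a\<in>V. \<Sum>c\<in>V. \<Sum>b\<in>V. \<Sum>d\<in>V. of_bool ((a, b, c, d) \<in> closed_walks4 E))"
    by (intro sum.cong refl sum.swap)
  also have "\<dots> = (\<Sum>a\<in>V. \<Sum>b\<in>V. \<Sum>c\<in>V. \<Sum>d\<in>V. of_bool ((a, b, c, d) \<in> closed_walks4 E))"
    by (intro sum.cong refl sum.swap)
  also have "\<dots> = (\<Sum>p\<in>V \<times> V \<times> V \<times> V. of_bool (p \<in> closed_walks4 E))"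
    by (simp add: sum.cartesian_product)
  also have "\<dots> = card (V \<times> V \<times> V \<times> V \<inter> closed_walks4 E)"
    using finite_V by (simp add: sum_of_bool_eq Int_def)
  also have "V \<times> V \<times> V \<times> V \<inter> closed_walks4 E = closed_walks4 E"
    using in_V by (auto simp: closed_walks4_def)
  finally show ?thesis .
qed

end

lemma spectral_moments:
  assumes "conn_graph (pverts G) (parcs G)"
  shows "spectral_moment 0 G = card (pverts G)" "spectral_moment 1 G = 0"
    "spectral_moment 2 G = card (parcs G)" "spectral_moment 3 G = card (triangles (parcs G))"
    "spectral_moment 4 G = card (closed_walks4 (parcs G))"
proof -
  interpret conn_graph "pverts G" "parcs G" by fact
  show "spectral_moment 0 G = card (pverts G)" "spectral_moment 1 G = 0"
    "spectral_moment 2 G = card (parcs G)" "spectral_moment 3 G = card (triangles (parcs G))"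
    "spectral_moment 4 G = card (closed_walks4 (parcs G))"
    unfolding spectral_moment_eq_closed_walks[OF finite_V sym_E]
    by (fact moment_0 moment_1 moment_2 moment_3 moment_4)+
qed

section \<open>Cut edges and isomorphisms of pair graphs\<close>

lemma reachable_iff_rtrancl:
  assumes "pair_wf_digraph G" "u \<in> pverts G"
  shows "u \<rightarrow>\<^sup>*\<^bsub>with_proj G\<^esub> v \<longleftrightarrow> (u, v) \<in> (parcs G)\<^sup>*"
proof
  interpret pair_wf_digraph G by fact
  show "(u, v) \<in> (parcs G)\<^sup>*" if "u \<rightarrow>\<^sup>*\<^bsub>with_proj G\<^esub> v"
    using reachable_rtranclI[OF that] by simp
  show "u \<rightarrow>\<^sup>*\<^bsub>with_proj G\<^esub> v" if "(u, v) \<in> (parcs G)\<^sup>*"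
    using that
  proof (induction rule: rtrancl_induct)
    case base
    show ?case using assms(2) by (simp add: reachable_def)
  next
    case (step y z)
    then show ?case
      using in_arcsD2[OF step(2)] by (auto simp: reachable_def intro: rtrancl_on_into_rtrancl_on)
  qed
qed

lemma pair_graph_iff:
  "pair_graph G \<longleftrightarrow> finite (pverts G) \<and> parcs G \<subseteq> pverts G \<times> pverts G \<and> sym (parcs G) \<and> irrefl (parcs G)"
proof
  assume "pair_graph G"
  then interpret pair_graph G .
  show "finite (pverts G) \<and> parcs G \<subseteq> pverts G \<times> pverts G \<and> sym (parcs G) \<and> irrefl (parcs G)"
    using pair_finite_verts in_arcsD1 in_arcsD2 pair_sym_arcs pair_no_loops
    by (fastforce simp: symmetric_def irrefl_def)
next
  assume *: "finite (pverts G) \<and> parcs G \<subseteq> pverts G \<times> pverts G \<and> sym (parcs G) \<and> irrefl (parcs G)"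
  then have "finite (parcs G)"
    by (meson finite_SigmaI finite_subset)
  with * show "pair_graph G"
    by unfold_locales (auto simp: symmetric_def irrefl_def)
qed

text \<open>Connectedness in the library is strong connectedness of the symmetric closure; the arcs
  are already symmetric, so it reduces to plain reachability.\<close>

lemma connected_pair_graph_iff:
  "pair_graph G \<and> Digraph_Component.connected (with_proj G) \<longleftrightarrow> conn_graph (pverts G) (parcs G)"
proof (cases "pair_graph G")
  case True
  then interpret pair_graph G .
  have "Digraph_Component.connected (with_proj G) \<longleftrightarrow>
      pverts G \<noteq> {} \<and> (\<forall>u\<in>pverts G. \<forall>v\<in>pverts G. u \<rightarrow>\<^sup>*\<^bsub>with_proj G\<^esub> v)"
    using pair_sym_arcs
    by (simp add: Digraph_Component.connected_def strongly_connected_def reachable_mk_symmetric_eq)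
  also have "\<dots> \<longleftrightarrow> pverts G \<noteq> {} \<and> (\<forall>u\<in>pverts G. \<forall>v\<in>pverts G. (u, v) \<in> (parcs G)\<^sup>*)"
    using reachable_iff_rtrancl[OF pair_wf_digraph_axioms] by simp
  finally show ?thesis
    using True by (auto simp: pair_graph_iff conn_graph_def)
next
  case False
  then show ?thesis
    by (auto simp: pair_graph_iff conn_graph_def)
qed

text \<open>After the deletion the only components are those of \<open>u\<close> and of
  \<open>v\<close>, and they are distinct exactly when \<open>v\<close> can no longer be reached
  from \<open>u\<close>.\<close>

lemma card_sccs_del_edge:
  assumes G: "conn_graph (pverts G) (parcs G)" and uv: "(u, v) \<in> parcs G"
  shows "card (pre_digraph.sccs (with_proj (del_edge G u v))) = 2 \<longleftrightarrow> (u, v) \<notin> (remove_edge (parcs G) u v)\<^sup>*"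
proof -
  interpret conn_graph "pverts G" "parcs G" by fact
  let ?D = "del_edge G u v" and ?F = "remove_edge (parcs G) u v"
  have D: "pverts ?D = pverts G" "parcs ?D = ?F"
    by (auto simp: del_edge_def remove_edge_def)
  have "sym ?F"
    using sym_E by (rule sym_remove_edge)
  then have "pair_graph ?D"
    unfolding pair_graph_iff D using finite_V E_subset irrefl_E
    by (auto simp: remove_edge_def irrefl_def)
  then interpret D: pair_graph ?D .
  have scc: "D.scc_of x = {y. (x, y) \<in> ?F\<^sup>*}" if "x \<in> pverts G" for x
  proof -
    have "x \<rightarrow>\<^sup>*\<^bsub>with_proj ?D\<^esub> y \<longleftrightarrow> (x, y) \<in> ?F\<^sup>*" for y
      using reachable_iff_rtrancl[OF D.pair_wf_digraph_axioms, of x y] that by (simp add: D)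
    moreover have "x \<rightarrow>\<^sup>*\<^bsub>with_proj ?D\<^esub> y \<Longrightarrow> y \<rightarrow>\<^sup>*\<^bsub>with_proj ?D\<^esub> x" for y
      by (rule symmetric_reachable[OF D.pair_sym_arcs])
    ultimately show ?thesis
      unfolding D.scc_of_def by blast
  qed
  have same: "{y. (x, y) \<in> ?F\<^sup>*} = {y. (z, y) \<in> ?F\<^sup>*} \<longleftrightarrow> (x, z) \<in> ?F\<^sup>*" for x z
    using rtrancl_sym[OF \<open>sym ?F\<close>] by (auto intro: rtrancl_trans)
  \<comment> \<open>Along a walk from \<open>u\<close> in \<open>G\<close>, a step over the deleted
    edge ends in \<open>u\<close> or \<open>v\<close>, from where reachability starts
    afresh.\<close>
  have reach: "(u, x) \<in> ?F\<^sup>* \<or> (v, x) \<in> ?F\<^sup>*" if "x \<in> pverts G" for x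
  proof -
    have "(u, x) \<in> (parcs G)\<^sup>*"
      using connected that uv in_V by blast
    then show ?thesis
    proof (induction rule: rtrancl_induct)
      case (step y z)
      then show ?case
        by (cases "(y, z) \<in> ?F") (auto simp: remove_edge_def intro: rtrancl_into_rtrancl)
    qed simp
  qed
  have "D.sccs_verts = D.scc_of ` pverts G"
    using D.sccs_verts_conv_scc_of by (simp add: D)
  also have "\<dots> = (\<lambda>x. {y. (x, y) \<in> ?F\<^sup>*}) ` pverts G"
    using scc by (intro image_cong) auto
  also have "\<dots> = {{y. (u, y) \<in> ?F\<^sup>*}, {y. (v, y) \<in> ?F\<^sup>*}}"
    using reach same uv in_V by blast
  finally have "card D.sccs = card {{y. (u, y) \<in> ?F\<^sup>*}, {y. (v, y) \<in> ?F\<^sup>*}}"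
    using D.card_sccs_verts by simp
  also have "\<dots> = 2 \<longleftrightarrow> (u, v) \<notin> ?F\<^sup>*"
    by (simp add: card_insert_if same)
  finally show ?thesis .
qed

lemma cut_edges_eq_bridges:
  assumes "conn_graph (pverts G) (parcs G)"
  shows "cut_edges G = bridges (parcs G)"
  unfolding cut_edges_def bridges_def using card_sccs_del_edge[OF assms] by blast

lemma graphs_with_cut_edges_iff:
  "G \<in> graphs_with_cut_edges n k \<longleftrightarrow>
    conn_graph (pverts G) (parcs G) \<and> card (pverts G) = n \<and> card (bridges (parcs G)) = k"
  unfolding graphs_with_cut_edges_def
  using connected_pair_graph_iff[of G] cut_edges_eq_bridges[of G] by auto

lemma digraph_iso_if_rel_iso:
  fixes G :: "'a pair_pre_digraph" and H :: "'b pair_pre_digraph"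
  assumes iso: "rel_iso f (pverts G) (parcs G) (pverts H) (parcs H)"
    and G: "pair_wf_digraph G" and H: "pair_wf_digraph H"
  shows "digraph_iso (with_proj G) (with_proj H)"
proof -
  interpret G: pair_wf_digraph G by fact
  interpret H: pair_wf_digraph H by fact
  have inj: "inj_on f (pverts G)" and surj: "f ` pverts G = pverts H"
    and iff: "\<And>x y. x \<in> pverts G \<Longrightarrow> y \<in> pverts G \<Longrightarrow> (f x, f y) \<in> parcs H \<longleftrightarrow> (x, y) \<in> parcs G"
    using iso by (auto simp: rel_iso_def bij_betw_def)
  define h where "h = \<lparr>iso_verts = f, iso_arcs = map_prod f f, iso_head = snd, iso_tail = fst\<rparr>"
  have sub: "parcs G \<subseteq> pverts G \<times> pverts G"
    using G.in_arcsD1 G.in_arcsD2 by auto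
  have "inj_on (map_prod f f) (parcs G)"
    by (rule inj_on_subset[OF _ sub]) (intro map_prod_inj_on inj)
  then have "pre_digraph.digraph_isomorphism (with_proj G) h"
    unfolding pre_digraph.digraph_isomorphism_def using inj G.wf_digraph_axioms by (simp add: h_def)
  moreover have "map_prod f f ` parcs G = parcs H"
  proof (intro equalityI subrelI)
    fix a b assume "(a, b) \<in> map_prod f f ` parcs G"
    then show "(a, b) \<in> parcs H"
      using iff G.in_arcsD1 G.in_arcsD2 by auto
  next
    fix a b assume ab: "(a, b) \<in> parcs H"
    then obtain x y where "x \<in> pverts G" "y \<in> pverts G" "a = f x" "b = f y"
      using surj H.in_arcsD1 H.in_arcsD2 by (metis imageE)
    then show "(a, b) \<in> map_prod f f ` parcs G"
      using ab iff by force
  qed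
  then have "with_proj H = app_iso h (with_proj G)"
    using surj by (simp add: app_iso_def h_def with_proj_def)
  ultimately show ?thesis
    unfolding digraph_iso_def by blast
qed

text \<open>The remainder wraps around only at \<open>i = n - k - 1\<close>, where it yields the
  closing arc to 0. All other arcs of cycle and tail together form one path through all
  vertices.\<close>

lemma cycle_with_tail_eq_lasso:
  assumes "k + 3 \<le> n"
  shows "pverts (cycle_with_tail n k) = {0..<n}" "parcs (cycle_with_tail n k) = lasso n (n - k)"
proof -
  show "pverts (cycle_with_tail n k) = {0..<n}"
    by (simp add: cycle_with_tail_def Let_def)
  let ?C = "{(i, Suc i mod (n - k)) | i. i < n - k} \<union> {(i, Suc i) | i. n - k - 1 \<le> i \<and> i < n - 1}"
  have "?C = {(i, Suc i) | i. i < n - 1} \<union> {(n - k - 1, 0)}" (is "_ = ?D")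
  proof (intro equalityI subrelI)
    fix x y assume "(x, y) \<in> ?C"
    then show "(x, y) \<in> ?D"
      using assms by (cases "Suc x = n - k") auto
  next
    fix x y assume "(x, y) \<in> ?D"
    then consider "y = Suc x" "x < n - k - 1" | "y = Suc x" "n - k - 1 \<le> x" "x < n - 1" | "x = n - k - 1" "y = 0"
      by fastforce
    then show "(x, y) \<in> ?C"
    proof cases
      case 1
      then show ?thesis by (auto intro!: exI[of _ x])
    next
      case 3
      then have "Suc x = n - k" using assms by linarith
      then show ?thesis using 3 by (auto intro!: exI[of _ x])
    qed auto
  qed
  then have "parcs (cycle_with_tail n k) = ?D \<union> ?D\<inverse>"
    by (simp add: cycle_with_tail_def Let_def)
  also have "\<dots> = lasso n (n - k)"
    by (auto simp: lasso_def path_rel_def)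
  finally show "parcs (cycle_with_tail n k) = lasso n (n - k)" .
qed

section \<open>Comparison with the competing graphs in the S-order\<close>

theorem theorem3p1:
  fixes n k :: nat
  assumes "k + 3 \<le> n"
  shows "cycle_with_tail n k \<in> graphs_with_cut_edges n k \<and>
    (\<forall>G :: 'a pair_pre_digraph. G \<in> graphs_with_cut_edges n k \<longrightarrow>
       \<not> digraph_iso (with_proj G) (with_proj (cycle_with_tail n k)) \<longrightarrow>
       cycle_with_tail n k \<prec>\<^sub>s G)"
proof (intro conjI allI impI)
  let ?P = "cycle_with_tail n k" and ?L = "lasso n (n - k)"
  note P = cycle_with_tail_eq_lasso[OF assms]
  have conn_P: "conn_graph (pverts ?P) (parcs ?P)"
    unfolding P using assms by (intro conn_graph_lasso) auto
  then interpret L: conn_graph "{0..<n}" ?L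
    unfolding P .
  have L: "card ?L = 2 * n" "card (bridges ?L) = k"
    using card_lasso[of "n - k" n] assms by auto
  show "?P \<in> graphs_with_cut_edges n k"
    unfolding graphs_with_cut_edges_iff using conn_P L by (simp add: P)
  fix G :: "'a pair_pre_digraph"
  assume "G \<in> graphs_with_cut_edges n k"
    and non_iso: "\<not> digraph_iso (with_proj G) (with_proj ?P)"
  then have conn_G: "conn_graph (pverts G) (parcs G)" and n: "card (pverts G) = n"
    and k: "card (bridges (parcs G)) = k"
    unfolding graphs_with_cut_edges_iff by auto
  interpret G: conn_graph "pverts G" "parcs G" by fact
  note moments = spectral_moments[OF conn_P, unfolded P, simplified] spectral_moments[OF conn_G, unfolded n]
  \<comment> \<open>Otherwise \<open>G\<close> would be a tree with \<open>n - 1\<close> bridges,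
    while \<open>k\<close> is at most \<open>n - 3\<close>.\<close>
  have "\<not> card (parcs G) < 2 * n"
    using G.few_edges n k assms by auto
  then consider "2 * n < card (parcs G)" | "card (parcs G) = 2 * n" by linarith
  then show "?P \<prec>\<^sub>s G"
  proof cases
    case 1
    have "spectral_moment i ?P = spectral_moment i G" if "i < 2" for i
      using that moments by (auto simp: less_2_cases_iff)
    moreover have "spectral_moment 2 ?P < spectral_moment 2 G"
      using 1 moments L by simp
    ultimately show ?thesis
      unfolding S_less_def using assms n by (auto simp: P intro!: bexI[of _ 2])
  next
    case 2
    then have E: "card (parcs G) = 2 * card (pverts G)"
      using n by simp
    have no_rel_iso: "\<not> rel_iso f (pverts G) (parcs G) {0..<n} ?L" for f
      using digraph_iso_if_rel_iso[of f G ?P] non_iso conn_G conn_P connected_pair_graph_iff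
      by (metis P pair_graph.axioms(1) pair_digraph.axioms(1) pair_fin_digraph.axioms(1))
    \<comment> \<open>Without a leaf besides \<open>v\<close>, the graph would be the lasso itself.
      This is used twice: an arbitrary vertex yields a first leaf, and that leaf yields a second
      one.\<close>
    have other_leaf: "\<exists>w\<in>pverts G - {v}. deg (parcs G) w = 1" if "v \<in> pverts G" for v
    proof (rule ccontr)
      assume no_leaf: "\<not> ?thesis"
      have "2 \<le> deg (parcs G) x" if "x \<in> pverts G - {v}" for x
      proof -
        have "deg (parcs G) x \<noteq> 1" using no_leaf that by blast
        moreover have "1 \<le> deg (parcs G) x" using G.deg_ge_1[of x] that n assms by simp
        ultimately show ?thesis by linarith
      qed
      then show False
        using G.lasso_iso[OF E that] no_rel_iso n k by auto
    qed
    obtain x where "x \<in> pverts G"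
      using G.nonempty by blast
    then obtain v where v: "v \<in> pverts G" "deg (parcs G) v = 1"
      using other_leaf by blast
    then obtain w where w: "w \<in> pverts G" "deg (parcs G) w = 1" "v \<noteq> w"
      using other_leaf by blast
    \<comment> \<open>This gives \<open>n \<ge> 5\<close>, so the deciding index 4 lies within the
      range up to \<open>n - 1\<close>.\<close>
    have "2 \<le> k"
      using G.two_leaves_two_bridges[OF v w] n k assms by simp
    \<comment> \<open>Both graphs have cycle length \<open>n - k\<close>, which alone determines the
      two counts.\<close>
    have tri: "card (triangles ?L) = card (triangles (parcs G))"
      and quads: "card (quads ?L) = card (quads (parcs G))"
      using L.unicyclic_core G.unicyclic_core[OF E] L n k by simp_all
    have "2 \<le> deg ?L x" if "x \<in> {0..<n} - {n - 1}" for x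
      using that assms by (intro deg_lasso_ge_2) auto
    then have "(\<Sum>x\<in>{0..<n}. (deg ?L x)\<^sup>2) \<le> 4 * n + 2"
      using L.sum_deg2_upper[of "n - 1"] L assms by simp
    also have "\<dots> < (\<Sum>x\<in>pverts G. (deg (parcs G) x)\<^sup>2)"
      using G.sum_deg2_lower[OF E v w] n by simp
    \<comment> \<open>With equal numbers of edges and 4-cycles, the gap between
      \<open>4 * n + 2\<close> and \<open>4 * n + 4\<close> in the sums of squared degrees
      decides.\<close>
    finally have "card (closed_walks4 ?L) < card (closed_walks4 (parcs G))"
      using L.card_closed_walks4 G.card_closed_walks4 quads L 2 by linarith
    then have "spectral_moment 4 ?P < spectral_moment 4 G"
      using moments by simp
    moreover have "spectral_moment i ?P = spectral_moment i G" if "i < 4" for i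
    proof -
      have "i = 0 \<or> i = 1 \<or> i = 2 \<or> i = 3"
        using that by presburger
      then show ?thesis
        using moments tri L 2 by (elim disjE) auto
    qed
    ultimately show ?thesis
      unfolding S_less_def using assms n \<open>2 \<le> k\<close> by (auto simp: P intro!: bexI[of _ 4])
  qed
qed

end
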